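(* Let $k=2p^\alpha$ with $p$ a prime and $\alpha\ge 0$ an integer, let $m\ge 1$ be an integer, and let $n(2,k,m)$ be a positive integer with the following property: for every $n'\ge n(2,k,m)$ and every $m$ continuous sections $s_1,\dots,s_m$ of $\Sigma^2(\gamma_{n'}^k)$ over $G_{n'}^k$ there exists $V\in G_{n'}^k$ such that every $s_i(V)$, $i=1,\dots,m$, is a real multiple of $Q(\gamma_{n'}^k)(V)$. Let $n\ge n(2,k,m)$, let $K_1,\dots,K_m$ be convex bodies in $\mathbb R^n$, and let $x$ be a point in the interior of $\bigcap_{i=1}^m K_i$. Then there exists a $k$-dimensional affine subspace $L\subseteq\mathbb R^n$ with $x\in L$ such that for every $i=1,\dots,m$ the section $K_i\cap L$ has a Euclidean ball (in $L$) as its John ellipsoid.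
   Context: $G_n^k$ is the Grassmannian of $k$-dimensional linear subspaces of $\mathbb R^n$, and $\gamma_n^k$ is its canonical (tautological) vector bundle, whose fiber over $V$ is $V$. $\Sigma^2(\gamma_n^k)$ is its fiberwise symmetric square; a continuous section of it is regarded as a continuous assignment of a quadratic form on $V$ to every $V\in G_n^k$. $Q(\gamma_n^k)$ is a Riemannian metric on $\gamma_n^k$, here the one given by restricting the standard quadratic form $x_1^2+\dots+x_n^2$ to each $V$. A multiple may be by any real scalar, including zero. The paper establishes that an integer $n(2,k,m)$ with the stated property exists for every $k=2p^\alpha$ and $m\ge1$, and that for $k=4$, $m=1$ one can take $12$. A convex body is a compact convex set with nonempty interior. The John ellipsoid of a convex body in a finite-dimensional Euclidean (affine) space $L$ is the unique ellipsoid of maximal volume contained in it. *)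

theory Defs
  imports "HOL-Analysis.Analysis" "HOL-Library.Function_Algebras"
begin

text \<open>
  Pointwise scalar multiplication on functions. It makes the library notions \<^term>\<open>subspace\<close>,
  \<^term>\<open>dim\<close> and \<^term>\<open>bilinear\<close> available for the model
  \<^term>\<open>topspace (Euclidean_space n)\<close> of $n$-space, in which \<open>n\<close> can be quantified.
\<close>

instantiation "fun" :: (type, real_vector) real_vector
begin

definition scaleR_fun :: "real \<Rightarrow> ('a \<Rightarrow> 'b) \<Rightarrow> 'a \<Rightarrow> 'b"
  where "scaleR_fun c f = (\<lambda>x. c *\<^sub>R f x)"

instance
  by standard (simp_all add: scaleR_fun_def fun_eq_iff scaleR_add_right scaleR_add_left)

end


section \<open>Grassmannians and quadratic forms on the tautological bundle\<close>

definition grassmannian :: "nat \<Rightarrow> nat \<Rightarrow> (nat \<Rightarrow> real) set set"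
  where "grassmannian n k =
    {V. subspace V \<and> V \<subseteq> topspace (Euclidean_space n) \<and> dim V = k}"

definition dot :: "nat \<Rightarrow> (nat \<Rightarrow> real) \<Rightarrow> (nat \<Rightarrow> real) \<Rightarrow> real"
  where "dot n v w = (\<Sum>i<n. v i * w i)"

definition std_quadratic_form :: "nat \<Rightarrow> (nat \<Rightarrow> real) \<Rightarrow> real"
  where "std_quadratic_form n v = (\<Sum>i<n. (v i)\<^sup>2)"

definition orth_proj :: "nat \<Rightarrow> (nat \<Rightarrow> real) set \<Rightarrow> (nat \<Rightarrow> real) \<Rightarrow> nat \<Rightarrow> real"
  where "orth_proj n V u = (THE p. p \<in> V \<and> (\<forall>w\<in>V. dot n (u - p) w = 0))"

text \<open>Row \<open>i\<close> of the projection matrix is the image of the \<open>i\<close>-th unit vector;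
  rows with index \<open>\<ge> n\<close> vanish.\<close>

definition proj_matrix :: "nat \<Rightarrow> (nat \<Rightarrow> real) set \<Rightarrow> nat \<Rightarrow> nat \<Rightarrow> real"
  where "proj_matrix n V i = orth_proj n V (\<lambda>j. of_bool (j = i))"

text \<open>The usual topology of the Grassmannian, through its embedding into the space of matrices
  that sends a subspace to the orthogonal projection onto it.\<close>

definition grassmannian_topology :: "nat \<Rightarrow> nat \<Rightarrow> (nat \<Rightarrow> real) set topology"
  where "grassmannian_topology n k =
    pullback_topology (grassmannian n k) (proj_matrix n) euclidean"

definition tautological_bundle :: "nat \<Rightarrow> nat \<Rightarrow> ((nat \<Rightarrow> real) set \<times> (nat \<Rightarrow> real)) topology"
  where "tautological_bundle n k =
    subtopology (prod_topology (grassmannian_topology n k) (Euclidean_space n))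
      (SIGMA V:grassmannian n k. V)"

text \<open>The bilinear form is taken on the whole vector space: every bilinear form on a subspace
  extends, so this is the same as a bilinear form on \<open>V\<close>.\<close>

definition quadratic_form_on :: "'a::real_vector set \<Rightarrow> ('a \<Rightarrow> real) \<Rightarrow> bool"
  where "quadratic_form_on V q \<longleftrightarrow>
    (\<exists>B. bilinear B \<and> (\<forall>v w. B v w = B w v) \<and> (\<forall>v\<in>V. q v = B v v))"

text \<open>A continuous section of the symmetric square of the tautological bundle, as a continuous
  family of quadratic forms on the fibers: \<open>s V\<close> is a quadratic form on \<open>V\<close>,
  and \<open>s V v\<close> depends continuously on the point \<open>(V, v)\<close> of the total space.
  Values of \<open>s V v\<close> with \<open>v\<close> outside \<open>V\<close> are irrelevant.\<close>

definition continuous_quadratic_section ::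
    "nat \<Rightarrow> nat \<Rightarrow> ((nat \<Rightarrow> real) set \<Rightarrow> (nat \<Rightarrow> real) \<Rightarrow> real) \<Rightarrow> bool"
  where "continuous_quadratic_section n k s \<longleftrightarrow>
    (\<forall>V\<in>grassmannian n k. quadratic_form_on V (s V)) \<and>
    continuous_map (tautological_bundle n k) euclideanreal (\<lambda>(V, v). s V v)"


section \<open>Convex bodies and John ellipsoids\<close>

definition convex_body :: "'a::euclidean_space set \<Rightarrow> bool"
  where "convex_body K \<longleftrightarrow> compact K \<and> convex K \<and> interior K \<noteq> {}"

definition affine_direction :: "'a::real_vector set \<Rightarrow> 'a set"
  where "affine_direction L = {a - b | a b. a \<in> L \<and> b \<in> L}"

definition ellipsoid_in :: "'a::euclidean_space set \<Rightarrow> 'a set \<Rightarrow> bool"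
  where "ellipsoid_in L E \<longleftrightarrow>
    (\<exists>c f. c \<in> L \<and> linear f \<and> f ` affine_direction L = affine_direction L \<and>
      E = (\<lambda>u. c + f u) ` (affine_direction L \<inter> cball 0 1))"

text \<open>\<open>(p, e)\<close> is an orthonormal coordinate system of \<open>L\<close> with origin \<open>p\<close>
  and axes \<open>e 0, \<dots>, e (k - 1)\<close>, where \<open>k\<close> is the dimension of \<open>L\<close>.\<close>

definition orthonormal_frame :: "'a::euclidean_space set \<Rightarrow> 'a \<times> (nat \<Rightarrow> 'a) \<Rightarrow> bool"
  where "orthonormal_frame L = (\<lambda>(p, e).
    let k = nat (aff_dim L) in
      (\<forall>i<k. \<forall>j<k. e i \<bullet> e j = of_bool (i = j)) \<and>
      L = {p + (\<Sum>i<k. t i *\<^sub>R e i) | t. True})"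

text \<open>Lebesgue measure of the dimension of \<open>L\<close> on a nonempty affine subspace \<open>L\<close>,
  computed in an orthonormal coordinate system; the choice is immaterial because isometries
  preserve Lebesgue measure. Meaningful for bounded Borel sets \<open>A\<close>.\<close>

definition affine_volume :: "'a::euclidean_space set \<Rightarrow> 'a set \<Rightarrow> real"
  where "affine_volume L A =
    (let k = nat (aff_dim L); (p, e) = (SOME fr. orthonormal_frame L fr) in
      measure (\<Pi>\<^sub>M i\<in>{..<k}. lborel)
        {t \<in> {..<k} \<rightarrow>\<^sub>E UNIV. p + (\<Sum>i<k. t i *\<^sub>R e i) \<in> A})"

definition max_volume_ellipsoid :: "'a::euclidean_space set \<Rightarrow> 'a set \<Rightarrow> 'a set \<Rightarrow> bool"
  where "max_volume_ellipsoid L K E \<longleftrightarrow>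
    ellipsoid_in L E \<and> E \<subseteq> K \<and>
    (\<forall>E'. ellipsoid_in L E' \<and> E' \<subseteq> K \<longrightarrow> affine_volume L E' \<le> affine_volume L E)"

definition john_ellipsoid :: "'a::euclidean_space set \<Rightarrow> 'a set \<Rightarrow> 'a set \<Rightarrow> bool"
  where "john_ellipsoid L K E \<longleftrightarrow>
    max_volume_ellipsoid L K E \<and> (\<forall>E'. max_volume_ellipsoid L K E' \<longrightarrow> E' = E)"

end

theory Submission
  imports Defs
begin

text \<open>
  A $k$-dimensional section of \<open>K i\<close> through \<open>x\<close> is given by $V \in G_n^k$, and
  $V \mapsto$ the squared support function of the centred John ellipsoid of the section is a
  continuous section of $\Sigma^2(\gamma_n^k)$. For the ellipsoid $c + G(V \cap B)$ this form is
  $v \mapsto v \cdot G G^T v$. If it is a multiple of the scalar product on \<open>V\<close>, the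
  ellipsoid is a ball, so the hypothesis yields the subspace.

  What has to be supplied is existence, uniqueness and continuity of the John ellipsoid. Subspaces
  are represented by their orthogonal projections \<open>P\<close>. For uniqueness, two maximal ellipsoids
  are brought to the form \<open>B\<close> and $d + R B$ with \<open>R\<close> symmetric positive of determinant 1; the
  ellipsoid $d/2 + \frac12(1+R)B$ is larger unless $R = 1$, and a stretching of \<open>B\<close> along \<open>d\<close>
  is larger unless $d = 0$. Uniqueness and compactness give continuity.
\<close>

section \<open>Linear algebra\<close>

text \<open>The subspace varies, so its ellipsoids have no common home. Extending each endomorphism
  of the range of P by the identity on the complement puts all of them into
  \<open>real^'n^'n\<close>: ordinary determinants compare volumes, and boundedness and limits are
  those of matrices, with bounds uniform in P. An ellipsoid determines G only up to an orthogonal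
  factor on the right, and an arbitrary choice of G need not vary continuously; G G^T is free of
  this ambiguity. The form forgets the centre, so the hypothesis constrains the shape alone and the
  balls may be centred away from x. The interior position of x serves twice: every section through x
  contains a ball, so a maximizer is nonsingular, and a slightly shrunken ellipsoid survives a small
  rotation of the subspace. Two translations remain. John ellipsoids are defined by a product
  measure in a chosen frame, which has to be matched with the determinant; and the hypothesis
  concerns functions on the naturals with a numerical dimension, while the bodies live in a vector
  type.\<close>

lemma selfadjoint_orthonormal_eigenbasis:
  fixes f :: "'a::euclidean_space \<Rightarrow> 'a"
  assumes "linear f" and adj: "\<And>x y. f x \<bullet> y = x \<bullet> f y"
  shows "subspace U \<Longrightarrow> f ` U \<subseteq> U \<Longrightarrow>
    \<exists>B. pairwise orthogonal B \<and> (\<forall>b\<in>B. norm b = 1 \<and> (\<exists>l. f b = l *\<^sub>R b)) \<and> span B = U"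
proof (induction "dim U" arbitrary: U rule: less_induct)
  case less
  interpret f: linear f by fact
  show ?case
  proof (cases "U = {0}")
    case True
    then show ?thesis by (intro exI[of _ "{}"]) auto
  next
    case False
    let ?S = "U \<inter> sphere 0 1"
    obtain u where u: "u \<in> U" "u \<noteq> 0"
      using False less.prems subspace_0 by blast
    have "compact ?S"
      by (simp add: closed_Int_compact closed_subspace less.prems)
    moreover have "u /\<^sub>R norm u \<in> ?S"
      using u less.prems by (simp add: subspace_scale)
    then have "?S \<noteq> {}" by blast
    moreover have "continuous_on ?S (\<lambda>x. f x \<bullet> x)"
      by (intro continuous_intros linear_continuous_on \<open>linear f\<close>[unfolded linear_conv_bounded_linear])
    \<comment> \<open>A maximizer v of the quadratic form on the unit sphere of U is an eigenvector.
      Self-adjointness makes \<open>f\<close> preserve the vectors of U orthogonal to v, and the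
      induction continues there.\<close>
    ultimately obtain v where v: "v \<in> ?S" and max: "\<And>y. y \<in> ?S \<Longrightarrow> f y \<bullet> y \<le> f v \<bullet> v"
      using continuous_attains_sup[of ?S] by blast
    define l where "l = f v \<bullet> v"
    have vv: "v \<bullet> v = 1" "v \<in> U"
      using v by (auto simp: dot_square_norm)
    have quad: "f y \<bullet> y \<le> l * (y \<bullet> y)" if "y \<in> U" for y
    proof (cases "y = 0")
      case True
      then show ?thesis by simp
    next
      case False
      have "f (y /\<^sub>R norm y) \<bullet> (y /\<^sub>R norm y) \<le> l"
        unfolding l_def using False that less.prems by (intro max) (simp add: subspace_scale)
      then show ?thesis
        using False by (simp add: f.scaleR field_simps dot_square_norm power2_eq_square)
    qed
    \<comment> \<open>The part of \<open>f v\<close> orthogonal to v. Moving from v in this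
      direction changes the Rayleigh quotient by a first-order term proportional to w . w, so
      maximality forces w = 0.\<close>
    define w where "w = f v - l *\<^sub>R v"
    have wU: "w \<in> U"
      unfolding w_def using less.prems vv by (auto intro!: subspace_diff subspace_scale)
    have wv: "w \<bullet> v = 0"
      by (simp add: w_def l_def inner_diff_left vv)
    have fvw: "f v \<bullet> w = w \<bullet> w"
      using wv by (simp add: w_def inner_diff_left inner_diff_right inner_commute)
    have lower: "2 * (w \<bullet> w) \<le> t * (l * (w \<bullet> w) - f w \<bullet> w)" if "t > 0" for t
    proof -
      have "f (v + t *\<^sub>R w) \<bullet> (v + t *\<^sub>R w) \<le> l * ((v + t *\<^sub>R w) \<bullet> (v + t *\<^sub>R w))"
        using less.prems vv wU by (intro quad subspace_add subspace_scale)
      moreover have "f w \<bullet> v = w \<bullet> w"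
        using adj[of w v] fvw by (simp add: inner_commute)
      ultimately have "l + 2 * t * (w \<bullet> w) + t\<^sup>2 * (f w \<bullet> w) \<le> l * (1 + t\<^sup>2 * (w \<bullet> w))"
        using wv fvw vv by (simp add: f.add f.scaleR inner_add_left inner_add_right
            l_def[symmetric] inner_commute[of v w] power2_eq_square algebra_simps)
      then have "t * (2 * (w \<bullet> w)) \<le> t * (t * (l * (w \<bullet> w) - f w \<bullet> w))"
        by (simp add: power2_eq_square algebra_simps)
      then show ?thesis
        using that by simp
    qed
    have "w \<bullet> w \<le> 0"
    proof (rule ccontr)
      assume pos: "\<not> w \<bullet> w \<le> 0"
      define c where "c = l * (w \<bullet> w) - f w \<bullet> w"
      \<comment> \<open>With this t the right-hand side of \<open>lower\<close> is at most w . w,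
        because c / (|c| + 1) is at most 1.\<close>
      have "(w \<bullet> w) / (\<bar>c\<bar> + 1) > 0" using pos by (intro divide_pos_pos) linarith+
      from lower[OF this] have "2 * (w \<bullet> w) \<le> (w \<bullet> w) * (c / (\<bar>c\<bar> + 1))"
        by (simp add: c_def)
      also have "\<dots> \<le> (w \<bullet> w) * 1"
        by (intro mult_left_mono) auto
      finally show False using pos by simp
    qed
    then have "w = 0"
      using inner_gt_zero_iff[of w] by linarith
    then have eig: "f v = l *\<^sub>R v"
      by (simp add: w_def)
    let ?U = "U \<inter> {y. v \<bullet> y = 0}"
    have sub: "subspace ?U"
      using less.prems by (intro subspace_inter subspace_hyperplane)
    have "v \<notin> ?U" using vv by auto
    then have "?U \<subset> U" using vv by blast
    then have "dim ?U < dim U"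
      using less.prems sub by (metis dim_psubset span_eq_iff)
    moreover have "f ` ?U \<subseteq> ?U"
    proof safe
      fix y assume "y \<in> U" "v \<bullet> y = 0"
      then show "f y \<in> U" "v \<bullet> f y = 0"
        using less.prems(2) adj[of v y] eig by auto
    qed
    ultimately obtain B where B: "pairwise orthogonal B"
        "\<forall>b\<in>B. norm b = 1 \<and> (\<exists>l. f b = l *\<^sub>R b)" "span B = ?U"
      using less.hyps[of ?U] sub by blast
    have "B \<subseteq> ?U" using B(3) span_superset by blast
    have "span (insert v B) = U"
    proof
      show "span (insert v B) \<subseteq> U"
        using vv \<open>B \<subseteq> ?U\<close> less.prems by (intro span_minimal) auto
      show "U \<subseteq> span (insert v B)"
      proof
        fix y assume "y \<in> U"
        then have "y - (v \<bullet> y) *\<^sub>R v \<in> ?U"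
          using vv less.prems by (auto intro!: subspace_diff subspace_scale simp: inner_diff_right)
        then show "y \<in> span (insert v B)"
          using B(3) span_breakdown_eq by blast
      qed
    qed
    moreover have "pairwise orthogonal (insert v B)"
      using B(1) \<open>B \<subseteq> ?U\<close> by (auto simp: pairwise_insert orthogonal_def inner_commute)
    ultimately show ?thesis
      using B v eig by (intro exI[of _ "insert v B"]) auto
  qed
qed

section \<open>Diagonal matrices and the spectral theorem for symmetric matrices\<close>

definition diag_mat :: "('n \<Rightarrow> real) \<Rightarrow> real^'n^'n"
  where "diag_mat d = (\<chi> i j. if i = j then d i else 0)"

lemma diag_mat_mult [simp]:
  "(diag_mat d ** A) $ i $ j = d i * A $ i $ j"
  "(A ** diag_mat d) $ i $ j = A $ i $ j * d j"
  by (simp_all add: diag_mat_def matrix_matrix_mult_def if_distrib if_distribR cong: if_cong)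

lemma diag_mat_vec [simp]: "(diag_mat d *v y) $ i = d i * y $ i"
proof -
  have "(diag_mat d *v y) $ i = (\<Sum>j\<in>UNIV. (if i = j then d i else 0) * y $ j)"
    by (simp add: diag_mat_def matrix_vector_mult_def)
  also have "\<dots> = (\<Sum>j\<in>UNIV. if i = j then d i * y $ j else 0)"
    by (intro sum.cong) auto
  finally show ?thesis by simp
qed

lemma det_diag_mat: "det (diag_mat d) = prod d UNIV"
  by (subst det_diagonal) (auto simp: diag_mat_def)

lemma transpose_diag_mat [simp]: "transpose (diag_mat d) = diag_mat d"
  by (auto simp: transpose_def diag_mat_def vec_eq_iff)

lemma diag_mat_times_diag_mat: "diag_mat d ** diag_mat e = diag_mat (\<lambda>i. d i * e i)"
  by (simp add: vec_eq_iff) (simp add: diag_mat_def)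

text \<open>An orthonormal eigenbasis is independent and spans, so it has exactly
  \<open>CARD('n)\<close> members. It can therefore be indexed by \<open>'n\<close> and taken as the
  columns of Q.\<close>

lemma symmetric_matrix_diagonalization:
  fixes T :: "real^'n^'n"
  assumes "transpose T = T"
  obtains Q d where "orthogonal_matrix Q" "T = Q ** diag_mat d ** transpose Q"
proof -
  have adj: "(T *v x) \<bullet> y = x \<bullet> (T *v y)" for x y
    by (metis assms dot_lmul_matrix transpose_matrix_vector)
  obtain B where B: "pairwise orthogonal B" "\<forall>b\<in>B. norm b = 1 \<and> (\<exists>l. T *v b = l *\<^sub>R b)"
      "span B = (UNIV :: (real^'n) set)"
    using selfadjoint_orthonormal_eigenbasis[of "(*v) T" UNIV] adj by auto
  have "independent B"
    using B by (intro pairwise_orthogonal_independent) (auto dest: bspec[of _ _ 0])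
  then have "finite B" "card B = CARD('n)"
    using B(3) by (auto simp: independent_imp_finite) (metis dim_eq_card_independent dim_span dim_UNIV DIM_cart DIM_real mult.right_neutral)
  then obtain e where e: "bij_betw e (UNIV::'n set) B"
    using finite_same_card_bij by (metis finite)
  then have eB: "e i \<in> B" for i by (auto simp: bij_betw_def)
  have "\<forall>i. \<exists>l. T *v e i = l *\<^sub>R e i"
    using B(2) eB by blast
  then obtain d where d: "\<And>i. T *v e i = d i *\<^sub>R e i"
    using choice[of "\<lambda>i l. T *v e i = l *\<^sub>R e i"] by blast
  have ee: "e i \<bullet> e j = of_bool (i = j)" for i j
  proof (cases "i = j")
    case True
    then show ?thesis using B(2) eB by (simp add: dot_square_norm)
  next
    case False
    then have "e i \<noteq> e j" using e by (auto simp: bij_betw_def inj_on_def)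
    then show ?thesis using False B(1) eB by (simp add: pairwise_def orthogonal_def)
  qed
  define Q where "Q = transpose (\<chi> i. e i)"
  have Q: "transpose Q ** Q = mat 1"
    using ee by (simp add: Q_def vec_eq_iff matrix_matrix_mult_def mat_def transpose_def inner_vec_def)
  have "T ** Q = Q ** diag_mat d"
    using d by (simp add: vec_eq_iff Q_def matrix_matrix_mult_def[of T] matrix_vector_mult_def transpose_def mult.commute)
  then have "T ** Q ** transpose Q = Q ** diag_mat d ** transpose Q" by simp
  then have "T = Q ** diag_mat d ** transpose Q"
    using Q by (metis matrix_left_right_inverse matrix_mul_assoc matrix_mul_rid)
  moreover have "orthogonal_matrix Q" using Q by (simp add: orthogonal_matrix)
  ultimately show ?thesis using that by blast
qed

lemma matrix_add_rdistrib: "(A + B) ** C = A ** C + B ** (C :: real^'p^'m)" for A B :: "real^'m^'n"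
  by (simp add: vec_eq_iff matrix_matrix_mult_def sum.distrib algebra_simps)

lemma matrix_diff_ldistrib: "C ** (A - B) = C ** A - C ** B" for A B :: "real^'m^'n" and C :: "real^'n^'p"
  by (simp add: vec_eq_iff matrix_matrix_mult_def sum_subtractf algebra_simps)

lemma matrix_diff_rdistrib: "(A - B) ** C = A ** C - B ** (C :: real^'p^'m)" for A B :: "real^'m^'n"
  by (simp add: vec_eq_iff matrix_matrix_mult_def sum_subtractf algebra_simps)

lemma transpose_diff: "transpose (A - B) = transpose A - transpose (B :: real^'m^'n)"
  by (simp add: vec_eq_iff transpose_def)

lemmas matrix_distribs = matrix_add_ldistrib matrix_add_rdistrib matrix_diff_ldistrib matrix_diff_rdistrib
  scalar_matrix_assoc[symmetric] matrix_scalar_ac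

section \<open>Orthogonal projections and endomorphisms of their ranges\<close>

definition proj_mat :: "real^'n^'n \<Rightarrow> bool"
  where "proj_mat P \<longleftrightarrow> transpose P = P \<and> P ** P = P"

text \<open>\<open>block P G\<close>: \<open>G\<close> maps the range of the projection \<open>P\<close> into itself and is the identity on the
  orthogonal complement, so that \<open>det G\<close> is the determinant of its restriction to the range.\<close>

definition block :: "real^'n^'n \<Rightarrow> real^'n^'n \<Rightarrow> bool"
  where "block P G \<longleftrightarrow> G ** (mat 1 - P) = mat 1 - P \<and> (mat 1 - P) ** G = mat 1 - P"

lemma block_commute:
  assumes "block P G"
  shows "G ** P = P ** G"
proof -
  have "G - G ** P = G - P ** G"
    using assms by (simp add: block_def matrix_diff_ldistrib matrix_diff_rdistrib)
  then show ?thesis by simp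
qed

lemma block_mat_1 [simp]: "block P (mat 1)"
  by (simp add: block_def)

lemma block_mult:
  assumes "block P A" "block P B"
  shows "block P (A ** B)"
  using assms by (simp add: block_def matrix_mul_assoc) (simp add: matrix_mul_assoc[symmetric])

lemma block_transpose:
  assumes "proj_mat P" "block P A"
  shows "block P (transpose A)"
proof -
  have *: "transpose (mat 1 - P) = mat 1 - P"
    using assms(1) by (simp add: proj_mat_def transpose_diff)
  then show ?thesis
    using assms(2) matrix_transpose_mul[of A "mat 1 - P"] matrix_transpose_mul[of "mat 1 - P" A]
    by (simp add: block_def)
qed

lemma block_inverse:
  assumes "block P A" "A ** B = mat 1"
  shows "block P B"
proof -
  let ?R = "mat 1 - P"
  have "B ** A = mat 1" using assms(2) matrix_left_right_inverse by blast
  then have "B ** (A ** ?R) = ?R" "(?R ** A) ** B = ?R"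
    using assms(2) by (simp_all add: matrix_mul_assoc) (simp add: matrix_mul_assoc[symmetric])
  then show ?thesis using assms(1) by (simp add: block_def)
qed

text \<open>The weights add up to 1, so the identity on the complement survives. Sums and multiples
  of block matrices are in general not block matrices.\<close>

lemma block_convex: "block P A \<Longrightarrow> block P B \<Longrightarrow> block P ((1 - t) *\<^sub>R A + t *\<^sub>R B)"
  unfolding block_def matrix_add_ldistrib matrix_add_rdistrib scalar_matrix_assoc[symmetric] matrix_scalar_ac
  by (simp add: scaleR_left_distrib[symmetric])

text \<open>A way to make a block matrix for P out of any A: compress A to the range, scale it
  there, and fill in the identity. It carries an ellipsoid over to a nearby subspace, and t rescales
  the range only.\<close>

lemma block_of_proj:
  assumes "proj_mat P"
  shows "block P (t *\<^sub>R (P ** A ** P) + (mat 1 - P))"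
proof -
  have "P ** P = P" using assms by (simp add: proj_mat_def)
  then have "P ** A ** P ** (mat 1 - P) = 0" "(mat 1 - P) ** (P ** A ** P) = 0"
      "(mat 1 - P) ** (mat 1 - P) = mat 1 - P"
    by (simp_all add: matrix_diff_ldistrib matrix_diff_rdistrib matrix_mul_assoc)
      (simp add: matrix_mul_assoc[symmetric])
  then show ?thesis
    by (simp add: block_def matrix_add_ldistrib matrix_add_rdistrib scalar_matrix_assoc[symmetric] matrix_scalar_ac)
qed

lemma block_apply_proj:
  assumes "block P G"
  shows "P *v (G *v y) = G *v (P *v y)"
  using block_commute[OF assms] by (simp add: matrix_vector_mul_assoc)

lemma norm_orthogonal_apply:
  fixes O' :: "real^'n^'n"
  assumes "O' ** transpose O' = mat 1"
  shows "norm (O' *v u) = norm u"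
proof -
  have "transpose O' ** O' = mat 1" using assms matrix_left_right_inverse by blast
  then have "(O' *v u) \<bullet> (O' *v u) = u \<bullet> u"
    by (metis dot_lmul_matrix matrix_vector_mul_assoc matrix_vector_mul_lid transpose_matrix_vector transpose_transpose)
  then show ?thesis by (simp add: norm_eq)
qed

text \<open>Strict concavity of log det in its diagonal form. By ((1 + a) / 2)^2 = a + ((1 - a) /
  2)^2 each quotient of the squared mean by \<open>s i\<close> is at least 1, and exceeds 1 unless
  \<open>s i = 1\<close>; the denominators multiply to 1.\<close>

lemma prod_average_gt_1:
  fixes s :: "'i \<Rightarrow> real"
  assumes "finite A" "\<And>i. i \<in> A \<Longrightarrow> 0 < s i" "prod s A = 1" "i \<in> A" "s i \<noteq> 1"
  shows "1 < (\<Prod>i\<in>A. (1 + s i) / 2)"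
proof -
  have *: "((1 + a) / 2)\<^sup>2 = a + ((1 - a) / 2)\<^sup>2" for a :: real
    by (simp add: power2_eq_square field_simps)
  have "1 < (\<Prod>i\<in>A. ((1 + s i) / 2)\<^sup>2 / s i)"
  proof (rule less_1_prod2[OF \<open>finite A\<close> \<open>i \<in> A\<close>])
    show "1 < ((1 + s i) / 2)\<^sup>2 / s i"
      using assms(2)[OF \<open>i \<in> A\<close>] \<open>s i \<noteq> 1\<close> by (subst *) (simp add: field_simps)
    show "1 \<le> ((1 + s j) / 2)\<^sup>2 / s j" if "j \<in> A" for j
      using assms(2)[OF that] by (subst *) (simp add: field_simps)
  qed
  also have "\<dots> = (\<Prod>i\<in>A. ((1 + s i) / 2)\<^sup>2)"
    by (simp only: prod_dividef assms(3) div_by_1)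
  finally have "1 < (\<Prod>i\<in>A. (1 + s i) / 2)\<^sup>2"
    by (simp only: prod_power_distrib)
  moreover have "0 \<le> (\<Prod>i\<in>A. (1 + s i) / 2)"
    using assms(2) by (intro prod_nonneg) (auto simp: less_imp_le add_nonneg_nonneg)
  ultimately show ?thesis
    using power_le_one[of "\<Prod>i\<in>A. (1 + s i) / 2" 2] by (meson not_less)
qed

lemma det_conj_orthogonal:
  assumes "orthogonal_matrix Q"
  shows "det (Q ** D ** transpose Q) = det (D :: real^'n^'n)"
proof -
  have "det Q * det (transpose Q) = 1"
    using assms by (metis det_I det_mul orthogonal_matrix_def)
  then show ?thesis by (simp add: det_mul)
qed

text \<open>In an orthonormal basis containing a, the matrix I + t a a^T is diagonal with one entry
  1 + t and all others 1.\<close>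

lemma det_rank_one_update:
  fixes a :: "real^'n"
  assumes "norm a = 1"
  shows "det (\<chi> i j. of_bool (i = j) + t * a $ i * a $ j) = 1 + t"
proof -
  fix k :: 'n
  obtain Q where Q: "orthogonal_matrix Q" "Q *v axis k 1 = a"
    using orthogonal_matrix_exists_basis assms by blast
  have Qk: "Q $ i $ k = a $ i" for i
    using Q(2) by (auto simp: matrix_vector_mult_def axis_def if_distrib cong: if_cong)
  have QQ: "(\<Sum>l\<in>UNIV. Q $ i $ l * Q $ j $ l) = of_bool (i = j)" for i j
  proof -
    have "(Q ** transpose Q) $ i $ j = of_bool (i = j)"
      using Q(1) by (simp add: orthogonal_matrix_def mat_def)
    then show ?thesis by (simp add: matrix_matrix_mult_def transpose_def)
  qed
  have "(Q ** diag_mat (\<lambda>l. 1 + (if l = k then t else 0)) ** transpose Q) $ i $ j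
      = of_bool (i = j) + t * a $ i * a $ j" for i j
  proof -
    have "(Q ** diag_mat (\<lambda>l. 1 + (if l = k then t else 0)) ** transpose Q) $ i $ j
        = (\<Sum>l\<in>UNIV. Q $ i $ l * Q $ j $ l + (if l = k then t * Q $ i $ l * Q $ j $ l else 0))"
      by (subst matrix_matrix_mult_def) (auto simp: transpose_def algebra_simps intro!: sum.cong)
    then show ?thesis
      by (simp add: sum.distrib QQ Qk)
  qed
  then have "(\<chi> i j. of_bool (i = j) + t * a $ i * a $ j)
      = Q ** diag_mat (\<lambda>l. 1 + (if l = k then t else 0)) ** transpose Q"
    by (simp add: vec_eq_iff)
  moreover have "(\<Prod>l\<in>UNIV. 1 + (if l = k then t else 0)) = 1 + t"
    by (subst prod.remove[of _ k]) auto
  ultimately show ?thesis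
    using Q(1) by (simp add: det_conj_orthogonal det_diag_mat)
qed

section \<open>Volume\<close>

text \<open>\<open>measure_linear_image\<close> of the library requires a well-ordered index type.\<close>

lemma measure_linear_image_cart:
  fixes f :: "real^'n \<Rightarrow> real^'n" and S :: "(real^'n) set"
  assumes "linear f" "S \<in> lmeasurable"
  shows "f ` S \<in> lmeasurable \<and> measure lebesgue (f ` S) = \<bar>det (matrix f)\<bar> * measure lebesgue S"
proof -
  let ?scales = "\<lambda>f :: real^'n \<Rightarrow> real^'n. \<forall>S\<in>lmeasurable. f ` S \<in> lmeasurable \<and>
    measure lebesgue (f ` S) = \<bar>det (matrix f)\<bar> * measure lebesgue S"
  \<comment> \<open>Every linear map is composed of maps that annihilate a coordinate, stretch the
    axes, swap two coordinates or shear, and determinants multiply under composition. For swaps and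
    shears it is enough to check the scaling factor on boxes.\<close>
  have "?scales f"
  proof (rule induct_linear_elementary[OF \<open>linear f\<close>])
    fix f g :: "real^'n \<Rightarrow> real^'n"
    assume "linear f" "linear g" and f: "?scales f" and g: "?scales g"
    then have "matrix (f \<circ> g) = matrix f ** matrix g" by (simp add: matrix_compose)
    then show "?scales (f \<circ> g)"
      using f g by (simp only: image_comp[symmetric] det_mul abs_mult mult.assoc) metis
  next
    fix f :: "real^'n \<Rightarrow> real^'n" and i
    assume f: "linear f" "\<And>x. f x $ i = 0"
    have "\<not> surj f" using f(2) by (metis one_index surj_def zero_neq_one)
    then have ninj: "\<not> inj f" using f(1) linear_injective_imp_surjective by blast
    then have "negligible (f ` S)" for S
      using f(1) negligible_linear_singular_image by blast
    then show "?scales f"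
      using ninj det_nz_iff_inj[OF f(1)] by (auto simp: negligible_iff_measure)
  next
    fix c :: "'n \<Rightarrow> real"
    have "matrix (\<lambda>x. \<chi> i. c i * x $ i) = diag_mat c"
      by (simp add: matrix_def diag_mat_def vec_eq_iff axis_def)
    then show "?scales (\<lambda>x. \<chi> i. c i * x $ i)"
      by (simp add: measurable_stretch measure_stretch det_diag_mat)
  next
    fix m n :: 'n assume "m \<noteq> n"
    let ?p = "Transposition.transpose m n"
    let ?h = "\<lambda>x :: real^'n. \<chi> i. x $ ?p i"
    have lin: "linear ?h" by (rule linearI) (simp_all add: vec_eq_iff)
    have p: "?p permutes UNIV" by (rule permutes_swap_id) auto
    have "matrix ?h = (\<chi> i. mat 1 $ ?p i)"
      by (auto simp: matrix_def mat_def vec_eq_iff axis_def)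
    then have det: "\<bar>det (matrix ?h)\<bar> = 1"
      by (simp add: det_permute_rows[OF p] flip: of_int_abs)
    define h where "h = ?h"
    have invol: "h (h x) = x" for x by (simp add: h_def vec_eq_iff)
    have all_p: "(\<forall>i. Q (?p i)) \<longleftrightarrow> (\<forall>i. Q i)" for Q
      by (metis transpose_involutory)
    have image: "h ` cbox a b = cbox (h a) (h b)" for a b
    proof (rule set_eqI)
      fix y
      have "y \<in> h ` cbox a b \<longleftrightarrow> h y \<in> cbox a b" using invol by (metis imageE imageI)
      also have "\<dots> \<longleftrightarrow> y \<in> cbox (h a) (h b)"
        using all_p[of "\<lambda>i. a $ ?p i \<le> y $ i \<and> y $ i \<le> b $ ?p i"]
        by (simp add: mem_box_cart h_def)
      finally show "y \<in> h ` cbox a b \<longleftrightarrow> y \<in> cbox (h a) (h b)" .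
    qed
    have meq: "measure lebesgue (h ` cbox a b) = 1 * measure lebesgue (cbox a b)" for a b
    proof -
      have empty: "cbox (h a) (h b) = {} \<longleftrightarrow> cbox a b = {}" unfolding image[symmetric] by simp
      show ?thesis
      proof (cases "cbox a b = {}")
        case False
        have "measure lborel (cbox (h a) (h b)) = (\<Prod>i\<in>UNIV. h b $ i - h a $ i)"
          using False empty by (intro content_cbox_cart) blast
        also have "\<dots> = (\<Prod>i\<in>UNIV. b $ i - a $ i)"
          using prod.permute[OF p, of "\<lambda>i. b $ i - a $ i"] by (simp add: o_def h_def)
        also have "\<dots> = measure lborel (cbox a b)"
          using content_cbox_cart[OF False] by simp
        finally show ?thesis by (simp add: image)
      qed simp
    qed
    show "?scales ?h"
    proof
      fix S :: "(real^'n) set" assume "S \<in> lmeasurable"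
      from measure_linear_sufficient[OF lin this meq[unfolded h_def]]
      show "?h ` S \<in> lmeasurable \<and> measure lebesgue (?h ` S) = \<bar>det (matrix ?h)\<bar> * measure lebesgue S"
        unfolding det by simp
    qed
  next
    fix m n :: 'n assume mn: "m \<noteq> n"
    let ?h = "\<lambda>x :: real^'n. \<chi> i. if i = m then x $ m + x $ n else x $ i"
    have lin: "linear ?h" by (rule linearI) (auto simp: vec_eq_iff algebra_simps)
    have "matrix ?h = (\<chi> k. if k = m then row m (mat 1) + 1 *s row n (mat 1) else row k (mat 1))"
      by (auto simp: matrix_def mat_def vec_eq_iff axis_def row_def)
    then have det: "det (matrix ?h) = 1"
      using det_row_operation[OF mn, of "mat 1 :: real^'n^'n" 1] by simp
    have meq: "measure lebesgue (?h ` cbox a b) = 1 * measure lebesgue (cbox a b)" for a b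
    proof (cases "cbox a b = {}")
      case False
      \<comment> \<open>Moving the lower corner to 0 meets the sign condition on the box in
        \<open>measure_shear_interval\<close>.\<close>
      have box: "cbox a b = (+) a ` cbox 0 (b - a)"
        using cbox_translation[of a 0 "b - a"] by simp
      have "?h ` cbox a b = (+) (?h a) ` ?h ` cbox 0 (b - a)"
        unfolding box image_image using linear_add[OF lin] by simp
      then have "measure lebesgue (?h ` cbox a b) = measure lebesgue (?h ` cbox 0 (b - a))"
        by (simp only: measure_translation)
      also have "\<dots> = measure lebesgue (cbox 0 (b - a))"
        using False box by (intro measure_shear_interval[OF mn]) auto
      also have "\<dots> = 1 * measure lebesgue (cbox a b)"
        unfolding box by (simp only: measure_translation mult_1)
      finally show ?thesis .
    qed simp
    show "?scales ?h"
    proof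
      fix S :: "(real^'n) set" assume "S \<in> lmeasurable"
      from measure_linear_sufficient[OF lin this meq]
      show "?h ` S \<in> lmeasurable \<and> measure lebesgue (?h ` S) = \<bar>det (matrix ?h)\<bar> * measure lebesgue S"
        unfolding det by simp
    qed
  qed
  with assms show ?thesis by blast
qed

lemma inner_axis_cart: "y \<bullet> axis i 1 = (y :: real^'n) $ i"
  by (simp add: inner_axis)

lemma measurable_cart_coordinates:
  fixes b :: "'n::finite \<Rightarrow> nat"
  assumes b: "bij_betw b UNIV {..<n}"
  shows "(\<lambda>t. \<chi> j. t (b j)) \<in> (Pi\<^sub>M {..<n} (\<lambda>_. lborel :: real measure)) \<rightarrow>\<^sub>M (borel :: (real^'n) measure)"
proof (rule borel_measurable_euclidean_space[THEN iffD2], rule ballI)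
  fix v :: "real^'n" assume "v \<in> Basis"
  then obtain j where v: "v = axis j 1" by (auto simp: Basis_vec_def)
  have "b j < n" using b by (auto simp: bij_betw_def)
  then have "(\<lambda>t. t (b j)) \<in> (Pi\<^sub>M {..<n} (\<lambda>_. lborel :: real measure)) \<rightarrow>\<^sub>M lborel"
    by (intro measurable_component_singleton) simp
  then show "(\<lambda>t. (\<chi> j. t (b j)) \<bullet> v) \<in> borel_measurable (\<Pi>\<^sub>M i\<in>{..<n}. lborel)"
    by (simp add: inner_axis_cart v)
qed

text \<open>Connects the product measure underlying \<open>affine_volume\<close> with Lebesgue
  measure on vectors. The two agree on open boxes, and these determine
  \<open>lborel\<close>.\<close>

lemma distr_lborel_cart:
  fixes b :: "'n::finite \<Rightarrow> nat"
  assumes b: "bij_betw b UNIV {..<n}"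
  shows "distr (\<Pi>\<^sub>M i\<in>{..<n}. lborel) borel (\<lambda>t. \<chi> j. t (b j)) = (lborel :: (real^'n) measure)"
proof (rule lborel_eqI[symmetric])
  interpret product_sigma_finite "\<lambda>_::nat. lborel :: real measure" ..
  interpret finite_product_sigma_finite "\<lambda>_::nat. lborel :: real measure" "{..<n}" by standard simp
  have b_less: "b j < n" for j using b by (auto simp: bij_betw_def)
  note meas = measurable_cart_coordinates[OF b]
  fix l u :: "real^'n" assume le: "\<And>v. v \<in> Basis \<Longrightarrow> l \<bullet> v \<le> u \<bullet> v"
  have le': "l $ j \<le> u $ j" for j using le[of "axis j 1"] by (simp add: inner_axis_cart)
  define r where "r = inv_into UNIV b"
  have r: "b (r i) = i" if "i < n" for i
    using b that by (simp add: r_def bij_betw_inv_into_right)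
  have r': "r (b j) = j" for j
    using b by (simp add: r_def bij_betw_inv_into_left)
  have "(\<lambda>t. \<chi> j. t (b j)) -` box l u \<inter> space (\<Pi>\<^sub>M i\<in>{..<n}. lborel)
      = (\<Pi>\<^sub>E i\<in>{..<n}. {l $ r i <..< u $ r i})" (is "?V = ?E")
  proof (rule set_eqI)
    fix t
    have "(\<forall>j. l $ j < t (b j) \<and> t (b j) < u $ j) \<longleftrightarrow> (\<forall>i<n. l $ r i < t i \<and> t i < u $ r i)"
      using r r' b_less by metis
    then show "t \<in> ?V \<longleftrightarrow> t \<in> ?E"
      by (auto simp: mem_box_cart space_PiM PiE_iff)
  qed
  then have "emeasure (distr (\<Pi>\<^sub>M i\<in>{..<n}. lborel) borel (\<lambda>t. \<chi> j. t (b j))) (box l u)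
      = (\<Prod>i<n. emeasure lborel {l $ r i <..< u $ r i})"
    by (simp add: emeasure_distr[OF meas] emeasure_PiM)
  also have "\<dots> = (\<Prod>i<n. ennreal (u $ r i - l $ r i))"
    using le' by simp
  also have "\<dots> = (\<Prod>j\<in>UNIV. ennreal (u $ j - l $ j))"
    using prod.reindex_bij_betw[OF b, of "\<lambda>i. ennreal (u $ r i - l $ r i)"] by (simp add: r')
  also have "\<dots> = (\<Prod>j\<in>UNIV. ennreal ((u - l) \<bullet> axis j 1))"
    by (simp add: inner_axis_cart)
  also have "\<dots> = (\<Prod>v\<in>(\<lambda>j. axis j 1) ` UNIV. ennreal ((u - l) \<bullet> v))"
    by (subst prod.reindex) (auto simp: inj_on_def axis_eq_axis)
  also have "(\<lambda>j. axis j 1) ` UNIV = (Basis :: (real^'n) set)"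
    by (auto simp: Basis_vec_def)
  also have "(\<Prod>v\<in>Basis. ennreal ((u - l) \<bullet> v)) = ennreal (\<Prod>v\<in>Basis. (u - l) \<bullet> v)"
    using le by (intro prod_ennreal) (simp add: inner_diff_left)
  finally show "emeasure (distr (\<Pi>\<^sub>M i\<in>{..<n}. lborel) borel (\<lambda>t. \<chi> j. t (b j))) (box l u)
      = ennreal (\<Prod>v\<in>Basis. (u - l) \<bullet> v)" .
qed simp

text \<open>Passing to the coordinates of an orthonormal basis is multiplication by an orthogonal
  matrix, whose determinant is 1 or -1. Compactness of M supplies measurability and finite
  measure.\<close>

lemma emeasure_PiM_orthonormal_coordinates:
  fixes e :: "nat \<Rightarrow> real^'n"
  assumes e: "\<And>i j. i < CARD('n) \<Longrightarrow> j < CARD('n) \<Longrightarrow> e i \<bullet> e j = of_bool (i = j)" and M: "compact M"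
  shows "emeasure (\<Pi>\<^sub>M i\<in>{..<CARD('n)}. lborel) {t \<in> {..<CARD('n)} \<rightarrow>\<^sub>E UNIV. (\<Sum>i<CARD('n). t i *\<^sub>R e i) \<in> M}
    = emeasure lborel M"
proof -
  let ?n = "CARD('n)"
  obtain b :: "'n \<Rightarrow> nat" where b: "bij_betw b UNIV {..<?n}"
    using finite_same_card_bij[of "UNIV :: 'n set" "{..<?n}"] by auto
  have b_less: "b j < ?n" for j using b by (auto simp: bij_betw_def)
  define Q :: "real^'n^'n" where "Q = transpose (\<chi> j. e (b j))"
  have "transpose Q ** Q = mat 1"
    using e b_less b by (auto simp: Q_def vec_eq_iff matrix_matrix_mult_def mat_def transpose_def
        inner_vec_def bij_betw_def inj_on_def of_bool_def)
  then have QQ: "transpose Q ** Q = mat 1" "Q ** transpose Q = mat 1"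
    using matrix_left_right_inverse by blast+
  have Qv: "Q *v (\<chi> j. t (b j)) = (\<Sum>i<?n. t i *\<^sub>R e i)" for t
  proof -
    have "(\<Sum>i<?n. t i *\<^sub>R e i) = (\<Sum>j\<in>UNIV. t (b j) *\<^sub>R e (b j))"
      using sum.reindex_bij_betw[OF b, of "\<lambda>i. t i *\<^sub>R e i"] by simp
    then show ?thesis
      by (simp add: Q_def vec_eq_iff matrix_vector_mult_def transpose_def mult.commute)
  qed
  let ?S = "(*v) (transpose Q) ` M"
  have S: "y \<in> ?S \<longleftrightarrow> Q *v y \<in> M" for y
  proof
    assume "Q *v y \<in> M"
    then have "transpose Q *v (Q *v y) \<in> ?S" by (rule imageI)
    then show "y \<in> ?S" by (simp only: matrix_vector_mul_assoc QQ matrix_vector_mul_lid)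
  qed (auto simp: matrix_vector_mul_assoc QQ simp del: transpose_matrix_vector)
  have cS: "compact ?S"
    using M by (intro compact_continuous_image matrix_vector_mult_linear_continuous_on)
  have "\<bar>det (transpose Q)\<bar> = 1"
  proof -
    have "det Q * det Q = 1" using QQ(1) by (metis det_I det_mul det_transpose)
    then show ?thesis by (auto simp: square_eq_1_iff)
  qed
  then have "measure lebesgue ?S = measure lebesgue M"
    using measure_linear_image_cart[of "(*v) (transpose Q)" M] lmeasurable_compact[OF M]
    by (simp del: transpose_matrix_vector det_transpose)
  then have "measure lborel ?S = measure lborel M"
    using cS M by (simp add: compact_imp_closed borel_closed)
  moreover have "emeasure lborel X = ennreal (measure lborel X)" if "compact X" for X :: "(real^'n) set"
    using emeasure_compact_finite[OF that] by (intro emeasure_eq_ennreal_measure) auto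
  ultimately have vol: "emeasure lborel ?S = emeasure lborel M"
    using cS M by simp
  note meas = measurable_cart_coordinates[OF b]
  have "emeasure lborel ?S = emeasure (distr (\<Pi>\<^sub>M i\<in>{..<?n}. lborel) borel (\<lambda>t. \<chi> j. t (b j))) ?S"
    unfolding distr_lborel_cart[OF b] ..
  also have "\<dots> = emeasure (\<Pi>\<^sub>M i\<in>{..<?n}. lborel) ((\<lambda>t. \<chi> j. t (b j)) -` ?S \<inter> space (\<Pi>\<^sub>M i\<in>{..<?n}. lborel))"
    using meas cS by (intro emeasure_distr) (auto simp: compact_imp_closed borel_closed)
  also have "(\<lambda>t. \<chi> j. t (b j)) -` ?S \<inter> space (\<Pi>\<^sub>M i\<in>{..<?n}. lborel)
      = {t \<in> {..<?n} \<rightarrow>\<^sub>E UNIV. (\<Sum>i<?n. t i *\<^sub>R e i) \<in> M}"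
    unfolding vimage_def S Qv by (auto simp: space_PiM)
  finally show ?thesis using vol by simp
qed

text \<open>\<open>affine_volume\<close> selects its frame with \<open>SOME\<close>; existence is
  what gives the selected frame its defining property.\<close>

lemma orthonormal_frame_exists:
  fixes L :: "'a::euclidean_space set"
  assumes "affine L" "L \<noteq> {}"
  shows "\<exists>fr. orthonormal_frame L fr"
proof -
  obtain x where x: "x \<in> L" using assms by blast
  define W where "W = (\<lambda>y. y - x) ` L"
  have W: "subspace W"
    unfolding W_def using assms x by (simp add: affine_diffs_subspace_subtract)
  have L: "L = (\<lambda>y. x + y) ` W" by (force simp: W_def)
  have k: "nat (aff_dim L) = dim W"
    using aff_dim_translation_eq[of x W] W by (simp add: L aff_dim_subspace)
  obtain B where B: "B \<subseteq> W" "pairwise orthogonal B" "\<And>x. x \<in> B \<Longrightarrow> norm x = 1"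
    "independent B" "card B = dim W" "span B = W"
    using orthonormal_basis_subspace[OF W] by blast
  have "finite B" using B(4) by (rule independent_imp_finite)
  then obtain e where e: "bij_betw e {..<dim W} B"
    using finite_same_card_bij[of "{..<dim W}" B] B(5) by auto
  have "e i \<bullet> e j = of_bool (i = j)" if "i < dim W" "j < dim W" for i j
  proof (cases "i = j")
    case True
    have "e i \<in> B" using e that by (auto simp: bij_betw_def)
    then show ?thesis using True B(3) by (simp add: dot_square_norm)
  next
    case False
    have "e i \<in> B" "e j \<in> B" "e i \<noteq> e j"
      using e that False by (auto simp: bij_betw_def inj_on_def)
    then show ?thesis using False B(2) by (simp add: pairwise_def orthogonal_def)
  qed
  moreover have "L = {x + (\<Sum>i<dim W. t i *\<^sub>R e i) | t. True}"
  proof -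
    have "y \<in> W \<longleftrightarrow> (\<exists>t. y = (\<Sum>i<dim W. t i *\<^sub>R e i))" for y
    proof -
      have "(\<Sum>v\<in>B. u v *\<^sub>R v) = (\<Sum>i<dim W. u (e i) *\<^sub>R e i)" for u
        using sum.reindex_bij_betw[OF e, of "\<lambda>v. u v *\<^sub>R v"] by simp
      then have W_eq: "W = {(\<Sum>i<dim W. u (e i) *\<^sub>R e i) | u. True}"
        using span_finite[OF \<open>finite B\<close>] B(6) by auto
      have "\<exists>u. \<forall>i<dim W. u (e i) = t i" for t :: "nat \<Rightarrow> real"
        using e by (intro exI[of _ "\<lambda>v. t (inv_into {..<dim W} e v)"]) (simp add: bij_betw_inv_into_left)
      then have ex: "\<exists>u. (\<Sum>i<dim W. t i *\<^sub>R e i) = (\<Sum>i<dim W. u (e i) *\<^sub>R e i)" for t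
        by (metis (no_types, lifting) lessThan_iff sum.cong)
      show ?thesis
        using W_eq ex by (simp add: set_eq_iff) metis
    qed
    then show ?thesis by (subst L) (auto simp: image_iff)
  qed
  ultimately have "orthonormal_frame L (x, e)"
    unfolding orthonormal_frame_def prod.case k Let_def by blast
  then show ?thesis by blast
qed

lemma orthonormal_family:
  fixes e :: "nat \<Rightarrow> 'a::real_inner"
  assumes e: "\<And>i j. i < k \<Longrightarrow> j < k \<Longrightarrow> e i \<bullet> e j = of_bool (i = j)"
  shows "inj_on e {..<k}" "pairwise orthogonal (e ` {..<k})" "0 \<notin> e ` {..<k}"
proof -
  show "inj_on e {..<k}"
  proof (rule inj_onI)
    fix i j assume "i \<in> {..<k}" "j \<in> {..<k}" "e i = e j"
    then show "i = j" using e[of i j] e[of i i] by (simp split: if_splits)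
  qed
  show "pairwise orthogonal (e ` {..<k})"
    using e by (auto simp: pairwise_def orthogonal_def)
  show "0 \<notin> e ` {..<k}"
  proof
    assume "0 \<in> e ` {..<k}"
    then obtain i where "i < k" "e i = 0" by auto
    then show False using e[of i i] by simp
  qed
qed

text \<open>The missing vectors are an orthonormal basis B of the orthogonal complement. Subtracting
  from y its expansion in the given vectors leaves an element of the complement, so the union spans,
  and counting gives \<open>k + card B = CARD('n)\<close>.\<close>

lemma orthonormal_list_extend:
  fixes e :: "nat \<Rightarrow> real^'n"
  assumes e: "\<And>i j. i < k \<Longrightarrow> j < k \<Longrightarrow> e i \<bullet> e j = of_bool (i = j)"
  obtains e' where "k \<le> CARD('n)" "\<And>i. i < k \<Longrightarrow> e' i = e i"
    "\<And>i j. i < CARD('n) \<Longrightarrow> j < CARD('n) \<Longrightarrow> e' i \<bullet> e' j = of_bool (i = j)"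
proof -
  let ?A = "e ` {..<k}"
  have inj: "inj_on e {..<k}" and A: "pairwise orthogonal ?A" and "0 \<notin> ?A"
    by (rule orthonormal_family[of k e], rule e; assumption)+
  define W where "W = {y. \<forall>a\<in>?A. a \<bullet> y = 0}"
  have "subspace W"
    by (auto simp: W_def subspace_def inner_add_right)
  then obtain B where B: "B \<subseteq> W" "pairwise orthogonal B" "\<And>x. x \<in> B \<Longrightarrow> norm x = 1"
    "independent B" "card B = dim W" "span B = W"
    by (rule orthonormal_basis_subspace) blast
  have "finite B" using B(4) by (rule independent_imp_finite)
  have AB: "a \<bullet> b = 0" if "a \<in> ?A" "b \<in> B" for a b
    using that B(1) by (auto simp: W_def)
  have AB': "e i \<bullet> b = 0" "b \<bullet> e i = 0" if "i < k" "b \<in> B" for i b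
    using AB[of "e i" b] that by (auto simp: inner_commute)
  have disj: "?A \<inter> B = {}"
  proof (rule ccontr)
    assume "?A \<inter> B \<noteq> {}"
    then obtain b where "b \<in> ?A" "b \<in> B" by blast
    then show False using AB[of b b] B(3)[of b] by simp
  qed
  have "pairwise orthogonal (?A \<union> B)"
    using A B(2) AB' by (auto simp: pairwise_def orthogonal_def)
  moreover have "0 \<notin> ?A \<union> B"
    using \<open>0 \<notin> ?A\<close> B(3)[of 0] by auto
  ultimately have ind: "independent (?A \<union> B)"
    by (rule pairwise_orthogonal_independent)
  have "y \<in> span (?A \<union> B)" for y
  proof -
    let ?y = "\<Sum>i<k. (e i \<bullet> y) *\<^sub>R e i"
    have "e j \<bullet> (y - ?y) = 0" if "j < k" for j
    proof -
      have "e j \<bullet> ?y = (\<Sum>i<k. if i = j then e i \<bullet> y else 0)"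
        unfolding inner_sum_right using e that by (intro sum.cong) auto
      then show ?thesis using that by (simp add: inner_diff_right)
    qed
    then have "y - ?y \<in> span B"
      unfolding B(6) by (auto simp: W_def)
    then have "y - ?y \<in> span (?A \<union> B)" using span_mono[of B "?A \<union> B"] by blast
    moreover have "?y \<in> span (?A \<union> B)"
      by (intro span_sum span_scale span_base) auto
    ultimately show ?thesis using span_add by fastforce
  qed
  then have "span (?A \<union> B) = UNIV" by blast
  then have "card (?A \<union> B) = CARD('n)"
    using dim_eq_card_independent[OF ind] by (metis dim_span dim_UNIV DIM_cart DIM_real mult.right_neutral)
  then have card: "k + card B = CARD('n)"
    using card_Un_disjoint[OF _ \<open>finite B\<close> disj] inj by (simp add: card_image)
  then have "card {k..<CARD('n)} = card B" by (simp flip: card)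
  then obtain g where g: "bij_betw g {k..<CARD('n)} B"
    using finite_same_card_bij[of "{k..<CARD('n)}" B] \<open>finite B\<close> by blast
  define e' where "e' = (\<lambda>i. if i < k then e i else g i)"
  have gB: "g i \<in> B" if "k \<le> i" "i < CARD('n)" for i
    using g that by (auto simp: bij_betw_def)
  have gg: "g i \<bullet> g j = of_bool (i = j)" if "k \<le> i" "i < CARD('n)" "k \<le> j" "j < CARD('n)" for i j
  proof (cases "i = j")
    case True
    then show ?thesis using B(3) gB that by (simp add: dot_square_norm)
  next
    case False
    then have "g i \<noteq> g j" using g that by (auto simp: bij_betw_def inj_on_def)
    then show ?thesis using False B(2) gB that by (simp add: pairwise_def orthogonal_def)
  qed
  have "e' i \<bullet> e' j = of_bool (i = j)" if "i < CARD('n)" "j < CARD('n)" for i j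
    using e AB' gB gg that unfolding e'_def by (auto simp: not_less)
  then show ?thesis
    using card by (intro that[of e']) (auto simp: e'_def)
qed

section \<open>Inscribed ellipsoids of maximal volume\<close>

text \<open>The pair \<open>(c, G)\<close> encodes the ellipsoid $c + G(V \cap B)$, where $V \cap B$, the unit ball of
  the range of \<open>P\<close>, is written as the image of the unit ball of the whole space under \<open>P\<close>.\<close>

definition inscribed :: "real^'n^'n \<Rightarrow> (real^'n) set \<Rightarrow> ((real^'n) \<times> (real^'n^'n)) set"
  where "inscribed P K = {(c, G). P *v c = c \<and> block P G \<and> (\<forall>u\<in>cball 0 1. c + G *v (P *v u) \<in> K)}"

definition max_inscribed :: "real^'n^'n \<Rightarrow> (real^'n) set \<Rightarrow> ((real^'n) \<times> (real^'n^'n)) \<Rightarrow> bool"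
  where "max_inscribed P K z \<longleftrightarrow> z \<in> inscribed P K \<and> (\<forall>z'\<in>inscribed P K. \<bar>det (snd z')\<bar> \<le> \<bar>det (snd z)\<bar>)"

lemma inner_matrix_vector: "(A *v x) \<bullet> y = x \<bullet> (transpose A *v y)" for A :: "real^'n^'m"
  using dot_lmul_matrix[of x "transpose A" y] by simp

text \<open>R is the positive factor in the polar decomposition of M, obtained by taking square
  roots of the eigenvalues of M M^T. These eigenvalues multiply to 1, so averaging R with the
  identity raises the determinant above 1 unless all of them equal 1.\<close>

lemma symmetric_sqrt:
  fixes M :: "real^'n^'n"
  assumes "proj_mat P" "block P M" "\<bar>det M\<bar> = 1"
  shows "\<exists>R. block P R \<and> transpose R = R \<and> R ** R = M ** transpose M \<and>
    (M ** transpose M = mat 1 \<or> 1 < det ((1/2) *\<^sub>R (mat 1 + R)))"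
proof -
  define T where "T = M ** transpose M"
  have "transpose T = T"
    by (simp add: T_def matrix_transpose_mul)
  then obtain Q d where Q: "orthogonal_matrix Q" and T: "T = Q ** diag_mat d ** transpose Q"
    by (rule symmetric_matrix_diagonalization)
  have QQ: "transpose Q ** Q = mat 1" "Q ** transpose Q = mat 1"
    using Q by (simp_all add: orthogonal_matrix_def)
  have D: "diag_mat d = transpose Q ** T ** Q"
  proof -
    have "transpose Q ** T ** Q = (transpose Q ** Q) ** diag_mat d ** (transpose Q ** Q)"
      unfolding T by (simp only: matrix_mul_assoc)
    then show ?thesis by (simp add: QQ)
  qed
  have det_T: "det T = 1"
    using assms(3) abs_mult_self_eq[of "det M"] by (simp add: T_def det_mul)
  have prod_d: "prod d UNIV = 1"
    using det_T unfolding T by (simp only: det_conj_orthogonal[OF Q] det_diag_mat)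
  have d_pos: "0 < d i" for i
  proof -
    have "d i = (transpose M *v (Q *v axis i 1)) \<bullet> (transpose M *v (Q *v axis i 1))"
    proof -
      have "diag_mat d *v axis i 1 = d i *\<^sub>R axis i 1"
        by (simp add: vec_eq_iff axis_def)
      then have "d i = axis i 1 \<bullet> (diag_mat d *v axis i 1)"
        by (simp add: inner_axis_axis)
      also have "\<dots> = axis i 1 \<bullet> (transpose Q *v (M *v (transpose M *v (Q *v axis i 1))))"
        by (simp only: D T_def matrix_vector_mul_assoc matrix_mul_assoc)
      also have "\<dots> = (Q *v axis i 1) \<bullet> (M *v (transpose M *v (Q *v axis i 1)))"
        by (simp only: inner_matrix_vector)
      also have "\<dots> = (transpose M *v (Q *v axis i 1)) \<bullet> (transpose M *v (Q *v axis i 1))"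
        by (simp only: inner_matrix_vector transpose_transpose)
      finally show ?thesis .
    qed
    then have "0 \<le> d i" by simp
    moreover have "d i \<noteq> 0"
      using prod_d prod_zero_iff[of UNIV d] by auto
    ultimately show ?thesis by simp
  qed
  define R where "R = Q ** diag_mat (\<lambda>i. sqrt (d i)) ** transpose Q"
  have RT: "transpose R = R"
    by (simp add: R_def matrix_transpose_mul matrix_mul_assoc)
  have "R ** R = Q ** diag_mat (\<lambda>i. sqrt (d i)) ** (transpose Q ** Q) ** diag_mat (\<lambda>i. sqrt (d i)) ** transpose Q"
    by (simp only: R_def matrix_mul_assoc)
  also have "\<dots> = Q ** (diag_mat (\<lambda>i. sqrt (d i)) ** diag_mat (\<lambda>i. sqrt (d i))) ** transpose Q"
    by (simp only: QQ matrix_mul_rid matrix_mul_assoc)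
  also have "\<dots> = T"
    using d_pos by (simp add: diag_mat_times_diag_mat T less_imp_le)
  finally have RR: "R ** R = T" .
  have "block P T"
    using assms by (simp add: T_def block_mult block_transpose)
  then have TP: "T ** (mat 1 - P) = mat 1 - P" by (simp add: block_def)
  \<comment> \<open>The block condition in eigencoordinates: fixing Z means that every entry of Z
    either vanishes or sits in a row with eigenvalue 1. This is unaffected by replacing the
    eigenvalues by their roots.\<close>
  let ?Z = "transpose Q ** (mat 1 - P)"
  have "diag_mat d ** ?Z = transpose Q ** T ** (Q ** transpose Q) ** (mat 1 - P)"
    unfolding D by (simp only: matrix_mul_assoc)
  also have "\<dots> = ?Z"
    using TP by (simp add: QQ) (simp add: matrix_mul_assoc[symmetric])
  finally have DZ: "diag_mat d ** ?Z = ?Z" .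
  have "sqrt (d i) * ?Z $ i $ j = ?Z $ i $ j" for i j
    using arg_cong[OF DZ, of "\<lambda>A. A $ i $ j"] by simp
  then have "diag_mat (\<lambda>i. sqrt (d i)) ** ?Z = ?Z"
    by (simp add: vec_eq_iff)
  then have "R ** (mat 1 - P) = Q ** ?Z"
    by (simp add: R_def flip: matrix_mul_assoc)
  also have "\<dots> = mat 1 - P"
    by (simp add: matrix_mul_assoc QQ)
  finally have RP: "R ** (mat 1 - P) = mat 1 - P" .
  have "transpose (mat 1 - P) = mat 1 - P"
    using assms(1) by (simp add: proj_mat_def transpose_diff)
  then have "(mat 1 - P) ** R = mat 1 - P"
    using RP RT matrix_transpose_mul[of R "mat 1 - P"] by simp
  with RP have "block P R" by (simp add: block_def)
  moreover have "1 < det ((1/2) *\<^sub>R (mat 1 + R))" if "T \<noteq> mat 1"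
  proof -
    have "\<exists>i. d i \<noteq> 1"
    proof (rule ccontr)
      assume "\<nexists>i. d i \<noteq> 1"
      then have "diag_mat d = mat 1" by (simp add: vec_eq_iff diag_mat_def mat_def)
      then show False using that QQ by (simp add: T)
    qed
    then obtain i where "sqrt (d i) \<noteq> 1" by auto
    moreover have "(\<Prod>i\<in>A. sqrt (d i)) = sqrt (prod d A)" if "finite A" for A
      using that by induction (simp_all add: real_sqrt_mult)
    ultimately have "1 < (\<Prod>i\<in>UNIV. (1 + sqrt (d i)) / 2)"
      using d_pos prod_d by (intro prod_average_gt_1[of UNIV _ i]) auto
    moreover have "diag_mat (\<lambda>i. (1 + sqrt (d i)) / 2) = (1/2) *\<^sub>R (mat 1 + diag_mat (\<lambda>i. sqrt (d i)))"
      by (simp add: vec_eq_iff diag_mat_def mat_def)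
    then have "Q ** diag_mat (\<lambda>i. (1 + sqrt (d i)) / 2) ** transpose Q = (1/2) *\<^sub>R (mat 1 + R)"
      by (simp add: R_def matrix_scalar_ac scalar_matrix_assoc[symmetric] matrix_add_ldistrib matrix_add_rdistrib QQ scaleR_right_distrib)
    then have "det ((1/2) *\<^sub>R (mat 1 + R)) = (\<Prod>i\<in>UNIV. (1 + sqrt (d i)) / 2)"
      by (metis det_conj_orthogonal[OF Q] det_diag_mat)
    ultimately show ?thesis by simp
  qed
  ultimately show ?thesis
    using RT RR unfolding T_def by blast
qed

text \<open>B and R differ by the right factor V = B^(-1) R, which is orthogonal and commutes with
  P. It maps the unit ball to itself, so A B and A R describe the same ellipsoid.\<close>

lemma inscribed_orthogonal:
  assumes "(c, A ** B) \<in> inscribed P K" "block P A" "block P B" "block P R" "R ** R = B ** transpose B" "transpose R = R"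
    "det B \<noteq> 0"
  shows "(c, A ** R) \<in> inscribed P K"
proof -
  have "invertible B" using assms(7) by (simp add: invertible_det_nz)
  then obtain C where C: "B ** C = mat 1" "C ** B = mat 1" by (auto simp: invertible_def)
  define V where "V = C ** R"
  have "V ** transpose V = C ** (R ** R) ** transpose C"
    by (simp add: V_def matrix_transpose_mul matrix_mul_assoc assms(6))
  also have "\<dots> = (C ** B) ** transpose (C ** B)"
    by (simp only: assms(5) matrix_transpose_mul matrix_mul_assoc)
  finally have V: "V ** transpose V = mat 1" using C by simp
  have "block P V"
    using assms C by (simp add: V_def block_mult block_inverse)
  have "c + (A ** R) *v (P *v u) \<in> K" if "u \<in> cball 0 1" for u
  proof -
    have "A ** R = A ** B ** V"
      unfolding V_def by (metis C(1) matrix_mul_assoc matrix_mul_lid)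
    then have "(A ** R) *v (P *v u) = (A ** B) *v (P *v (V *v u))"
      using block_apply_proj[OF \<open>block P V\<close>] by (simp add: matrix_vector_mul_assoc[symmetric])
    moreover have "V *v u \<in> cball 0 1"
      using that norm_orthogonal_apply[OF V] by simp
    ultimately show ?thesis
      using assms(1) by (auto simp: inscribed_def)
  qed
  then show ?thesis
    using assms by (auto simp: inscribed_def block_mult)
qed

text \<open>In coordinates where both ellipsoids are unit balls with centres d apart, their convex
  hull contains the unit ball about the midpoint stretched along d by the factor 1 + |d| / 2. Since
  d lies in the range of P, the stretching is a block matrix.\<close>

lemma inscribed_translate_stretch:
  assumes P: "proj_mat P" and K: "convex K"
    and c0: "(c0, G) \<in> inscribed P K" and c1: "(c1, G) \<in> inscribed P K"
    and "det G \<noteq> 0" "c0 \<noteq> c1"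
  shows "\<exists>z\<in>inscribed P K. \<bar>det G\<bar> < \<bar>det (snd z)\<bar>"
proof -
  have bG: "block P G" using c0 by (simp add: inscribed_def)
  have "invertible G" using \<open>det G \<noteq> 0\<close> by (simp add: invertible_det_nz)
  then obtain C where C: "G ** C = mat 1" "C ** G = mat 1" by (auto simp: invertible_def)
  define d where "d = C *v (c1 - c0)"
  have Gd: "G *v d = c1 - c0"
    by (simp add: d_def matrix_vector_mul_assoc C)
  then have "d \<noteq> 0" using \<open>c0 \<noteq> c1\<close> by auto
  have Pd: "P *v d = d"
    using c0 c1 block_inverse[OF bG C(1)]
    by (simp add: d_def block_apply_proj inscribed_def matrix_vector_mult_diff_distrib)
  define a where "a = d /\<^sub>R norm d"
  have "norm a = 1" using \<open>d \<noteq> 0\<close> by (simp add: a_def)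
  have d: "d = norm d *\<^sub>R a" using \<open>d \<noteq> 0\<close> by (simp add: a_def)
  \<comment> \<open>A is I + (|d| / 2) a a^T, the stretching in the unit direction a of d.\<close>
  define A where "A = (\<chi> i j. of_bool (i = j) + norm d / 2 * a $ i * a $ j)"
  have detA: "det A = 1 + norm d / 2"
    unfolding A_def using \<open>norm a = 1\<close> by (rule det_rank_one_update)
  have Av: "A *v y = y + ((1/2) * (a \<bullet> y)) *\<^sub>R d" for y
  proof -
    have "(A *v y) $ i = (\<Sum>j\<in>UNIV. (if j = i then y $ j else 0) + norm d / 2 * a $ i * (a $ j * y $ j))" for i
      unfolding A_def matrix_vector_mult_def by (auto intro!: sum.cong simp: algebra_simps)
    then have "(A *v y) $ i = y $ i + norm d / 2 * a $ i * (a \<bullet> y)" for i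
      by (simp only: sum.distrib sum_distrib_left[symmetric] inner_vec_def inner_real_def) simp
    moreover have "norm d * a $ i = d $ i" for i
      using d by (metis vector_scaleR_component real_scaleR_def)
    ultimately show ?thesis
      by (simp add: vec_eq_iff)
  qed
  have Pa: "P *v a = a"
    using Pd by (simp add: a_def matrix_vector_mult_scaleR)
  have aP: "a \<bullet> (P *v y) = a \<bullet> y" for y
    using P Pa inner_matrix_vector[of P a y] by (simp add: proj_mat_def del: transpose_matrix_vector)
  have PA: "P ** A = A ** P"
    by (simp add: matrix_eq matrix_vector_mul_assoc[symmetric] Av aP matrix_vector_right_distrib
        matrix_vector_mult_scaleR Pd)
  have "A ** (mat 1 - P) = mat 1 - P"
    by (simp add: matrix_eq matrix_vector_mul_assoc[symmetric] Av aP matrix_vector_mult_diff_rdistrib inner_diff_right)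
  with PA have bA: "block P A"
    by (simp add: block_def matrix_diff_ldistrib matrix_diff_rdistrib)
  let ?z = "((1/2) *\<^sub>R (c0 + c1), G ** A)"
  have "(1/2) *\<^sub>R (c0 + c1) + (G ** A) *v (P *v u) \<in> K" if "u \<in> cball 0 1" for u
  proof -
    \<comment> \<open>Each point of the stretched ellipsoid is a convex combination of one and the
      same point taken in the two translates. The weight t reflects its position along a: 0 at a . u
      = -1 and 1 at a . u = 1.\<close>
    define t where "t = (1 + a \<bullet> u) / 2"
    have "\<bar>a \<bullet> u\<bar> \<le> 1"
      using Cauchy_Schwarz_ineq2[of a u] that \<open>norm a = 1\<close> by simp
    then have t: "0 \<le> t" "t \<le> 1" by (auto simp: t_def)
    have "(G ** A) *v (P *v u) = G *v (P *v u) + ((1/2) * (a \<bullet> u)) *\<^sub>R (c1 - c0)"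
      by (simp add: matrix_vector_mul_assoc[symmetric] Av aP matrix_vector_right_distrib
          matrix_vector_mult_scaleR Gd)
    then have "(1/2) *\<^sub>R (c0 + c1) + (G ** A) *v (P *v u)
        = (1 - t) *\<^sub>R (c0 + G *v (P *v u)) + t *\<^sub>R (c1 + G *v (P *v u))"
      by (simp only:) (simp add: t_def vec_eq_iff field_simps)
    also have "\<dots> \<in> K"
      using c0 c1 that t by (intro convexD[OF K]) (auto simp: inscribed_def)
    finally show ?thesis .
  qed
  then have "?z \<in> inscribed P K"
    using c0 c1 bG bA by (simp add: inscribed_def block_mult matrix_vector_right_distrib matrix_vector_mult_scaleR)
  moreover have "\<bar>det G\<bar> < \<bar>det (snd ?z)\<bar>"
    using \<open>d \<noteq> 0\<close> \<open>det G \<noteq> 0\<close> by (simp add: det_mul detA abs_mult)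
  ultimately show ?thesis by blast
qed

lemma max_inscribed_unique:
  assumes P: "proj_mat P" and K: "convex K"
    and z0: "max_inscribed P K (c0, G0)" and z1: "max_inscribed P K (c1, G1)" and "det G0 \<noteq> 0"
  shows "c0 = c1 \<and> G0 ** transpose G0 = G1 ** transpose G1"
proof -
  have in0: "(c0, G0) \<in> inscribed P K" and in1: "(c1, G1) \<in> inscribed P K"
    and max: "\<And>z. z \<in> inscribed P K \<Longrightarrow> \<bar>det (snd z)\<bar> \<le> \<bar>det G0\<bar>"
    using z0 z1 by (auto simp: max_inscribed_def)
  have det_eq: "\<bar>det G0\<bar> = \<bar>det G1\<bar>"
    using z0 z1 unfolding max_inscribed_def by (metis snd_conv order_antisym)
  have b0: "block P G0" and b1: "block P G1"
    using in0 in1 by (auto simp: inscribed_def)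
  have "invertible G0" using \<open>det G0 \<noteq> 0\<close> by (simp add: invertible_det_nz)
  then obtain C where C: "G0 ** C = mat 1" "C ** G0 = mat 1" by (auto simp: invertible_def)
  \<comment> \<open>In coordinates that turn the first ellipsoid into the unit ball, the second one
    has the matrix M. Equal volumes make |det M| = 1, and the polar decomposition exchanges M for
    the symmetric R.\<close>
  define M where "M = C ** G1"
  have M: "G1 = G0 ** M" by (simp add: M_def matrix_mul_assoc C)
  have bM: "block P M"
    unfolding M_def by (rule block_mult[OF block_inverse[OF b0 C(1)] b1])
  have "\<bar>det M\<bar> = 1"
    using det_eq \<open>det G0 \<noteq> 0\<close> by (simp add: M det_mul abs_mult)
  then obtain R where R: "block P R" "transpose R = R" "R ** R = M ** transpose M"
    "M ** transpose M = mat 1 \<or> 1 < det ((1/2) *\<^sub>R (mat 1 + R))"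
    using symmetric_sqrt[OF P bM] by blast
  have "det M \<noteq> 0" using \<open>\<bar>det M\<bar> = 1\<close> by auto
  have inM: "(c1, G0 ** M) \<in> inscribed P K" using in1 M by simp
  have inR: "(c1, G0 ** R) \<in> inscribed P K"
    by (rule inscribed_orthogonal[OF inM b0 bM R(1,3,2) \<open>det M \<noteq> 0\<close>])
  let ?A = "(1/2) *\<^sub>R (mat 1 + R)"
  have "?A = (1 - 1/2) *\<^sub>R mat 1 + (1/2) *\<^sub>R R" by (simp add: scaleR_right_distrib)
  then have bA: "block P ?A" using block_convex[OF block_mat_1 R(1)] by metis
  have "(1/2) *\<^sub>R (c0 + c1) + (G0 ** ?A) *v (P *v u) \<in> K" if "u \<in> cball 0 1" for u
  proof -
    have "(1/2) *\<^sub>R (c0 + c1) + (G0 ** ?A) *v (P *v u)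
      = (1/2) *\<^sub>R (c0 + G0 *v (P *v u)) + (1/2) *\<^sub>R (c1 + (G0 ** R) *v (P *v u))"
      by (simp add: matrix_scalar_ac scalar_matrix_assoc[symmetric] matrix_add_ldistrib scaleR_right_distrib
          matrix_vector_mult_add_rdistrib scaleR_matrix_vector_assoc[symmetric])
    also have "\<dots> \<in> K"
      using in0 inR that by (intro convexD[OF K]) (auto simp: inscribed_def)
    finally show ?thesis .
  qed
  then have "((1/2) *\<^sub>R (c0 + c1), G0 ** ?A) \<in> inscribed P K"
    using in0 in1 b0 bA by (simp add: inscribed_def block_mult matrix_vector_right_distrib matrix_vector_mult_scaleR)
  \<comment> \<open>The averaged ellipsoid is inscribed by convexity. Maximality bounds its relative
    volume by 1, which excludes the second alternative of \<open>R(4)\<close>.\<close>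
  from max[OF this] have "\<bar>det ?A\<bar> \<le> 1"
    using \<open>det G0 \<noteq> 0\<close> by (simp add: det_mul abs_mult del: det_matrix_scaleR)
  then have MM: "M ** transpose M = mat 1"
    using R(4) by force
  have "G1 ** transpose G1 = G0 ** (M ** transpose M) ** transpose G0"
    by (simp only: M matrix_transpose_mul matrix_mul_assoc)
  then have GG: "G1 ** transpose G1 = G0 ** transpose G0" by (simp add: MM)
  \<comment> \<open>As M is orthogonal, the second ellipsoid is a translate of the first: the
    identity takes the place of R.\<close>
  have "(c1, G0 ** mat 1) \<in> inscribed P K"
    by (rule inscribed_orthogonal[OF inM b0 bM]) (simp_all add: MM \<open>det M \<noteq> 0\<close>)
  then have "c0 = c1"
    using inscribed_translate_stretch[OF P K in0 _ \<open>det G0 \<noteq> 0\<close>, of c1] max by force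
  with GG show ?thesis by simp
qed

section \<open>Compactness and continuous dependence of the maximal ellipsoid on the
  subspace\<close>

lemma tendsto_matrix_matrix_mult [tendsto_intros]:
  fixes f :: "'a \<Rightarrow> real^'m^'n" and g :: "'a \<Rightarrow> real^'p^'m"
  shows "(f \<longlongrightarrow> A) F \<Longrightarrow> (g \<longlongrightarrow> B) F \<Longrightarrow> ((\<lambda>x. f x ** g x) \<longlongrightarrow> A ** B) F"
  unfolding matrix_matrix_mult_def by (intro tendsto_intros)

lemma tendsto_matrix_vector_mult [tendsto_intros]:
  fixes f :: "'a \<Rightarrow> real^'m^'n"
  shows "(f \<longlongrightarrow> A) F \<Longrightarrow> (g \<longlongrightarrow> y) F \<Longrightarrow> ((\<lambda>x. f x *v g x) \<longlongrightarrow> A *v y) F"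
  unfolding matrix_vector_mult_def by (intro tendsto_intros)

lemma tendsto_transpose [tendsto_intros]:
  fixes f :: "'a \<Rightarrow> real^'m^'n"
  shows "(f \<longlongrightarrow> A) F \<Longrightarrow> ((\<lambda>x. transpose (f x)) \<longlongrightarrow> transpose A) F"
  unfolding transpose_def by (intro tendsto_intros)

lemma tendsto_det [tendsto_intros]:
  fixes f :: "'a \<Rightarrow> real^'n^'n"
  shows "(f \<longlongrightarrow> A) F \<Longrightarrow> ((\<lambda>x. det (f x)) \<longlongrightarrow> det A) F"
  unfolding det_def by (intro tendsto_intros)

lemma norm_matrix_le:
  fixes A :: "real^'m^'n"
  assumes "\<And>i j. \<bar>A $ i $ j\<bar> \<le> b"
  shows "norm A \<le> real (CARD('n) * CARD('m)) * b"
proof -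
  have "norm A \<le> (\<Sum>i\<in>UNIV. norm (A $ i))"
    unfolding norm_vec_def[of A] by (intro L2_set_le_sum) auto
  also have "\<dots> \<le> (\<Sum>i\<in>(UNIV :: 'n set). real CARD('m) * b)"
  proof (rule sum_mono)
    fix i
    have "norm (A $ i) \<le> (\<Sum>j\<in>UNIV. \<bar>A $ i $ j\<bar>)" by (rule norm_le_l1_cart)
    also have "\<dots> \<le> (\<Sum>j\<in>(UNIV :: 'm set). b)" using assms by (intro sum_mono)
    finally show "norm (A $ i) \<le> real CARD('m) * b" by simp
  qed
  finally show ?thesis by simp
qed

lemma norm_matrix_vector_mult_le: "norm (A *v u) \<le> norm A * norm u" for A :: "real^'m^'n"
proof -
  have "norm (A *v u) \<le> L2_set (\<lambda>i. norm (A $ i) * norm u) UNIV"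
    unfolding norm_vec_def[of "A *v u"]
  proof (rule L2_set_mono)
    fix i show "norm ((A *v u) $ i) \<le> norm (A $ i) * norm u"
      using Cauchy_Schwarz_ineq2[of "A $ i" u] by (simp add: matrix_vector_mul_component)
  qed auto
  also have "\<dots> = norm A * norm u"
    by (simp add: norm_vec_def[of A] L2_set_left_distrib)
  finally show ?thesis .
qed

lemma proj_mat_inner: "proj_mat P \<Longrightarrow> (P *v x) \<bullet> y = x \<bullet> (P *v y)"
  using inner_matrix_vector[of P x y] by (simp add: proj_mat_def del: transpose_matrix_vector)

lemma proj_mat_idem [simp]: "proj_mat P \<Longrightarrow> P *v (P *v x) = P *v x"
  by (simp add: matrix_vector_mul_assoc proj_mat_def)

lemma norm_complement_le:
  assumes "proj_mat P"
  shows "norm (u - P *v u) \<le> norm u"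
proof -
  have "u \<bullet> u = (P *v u) \<bullet> (P *v u) + (u - P *v u) \<bullet> (u - P *v u)"
    using assms by (simp add: inner_diff_left inner_diff_right proj_mat_inner)
  then have "(u - P *v u) \<bullet> (u - P *v u) \<le> u \<bullet> u"
    using inner_ge_zero[of "P *v u"] by linarith
  then show ?thesis by (simp add: norm_le)
qed

lemma norm_proj_mat_le:
  assumes "proj_mat P"
  shows "norm (P *v u) \<le> norm u"
proof -
  have "proj_mat (mat 1 - P)"
    using assms by (simp add: proj_mat_def transpose_diff matrix_diff_ldistrib matrix_diff_rdistrib)
  from norm_complement_le[OF this, of u] show ?thesis
    by (simp add: matrix_vector_mult_diff_rdistrib)
qed

lemma block_apply: "block P G \<Longrightarrow> G *v u = G *v (P *v u) + (u - P *v u)"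
proof -
  assume "block P G"
  then have "G *v u - G *v (P *v u) = u - P *v u"
    unfolding block_def
    by (metis matrix_vector_mul_assoc matrix_vector_mul_lid matrix_vector_mult_diff_distrib matrix_vector_mult_diff_rdistrib)
  then show ?thesis by (simp add: algebra_simps)
qed

text \<open>On its own subspace and with t = 1, the matrix of \<open>block_of_proj\<close> is G
  again. Hence letting t tend to 1 recovers the original ellipsoid after a perturbation
  argument.\<close>

lemma block_eq: "proj_mat P \<Longrightarrow> block P G \<Longrightarrow> P ** G ** P + (mat 1 - P) = G"
proof -
  assume P: "proj_mat P" and G: "block P G"
  have "P ** G ** P = G ** P"
    using block_commute[OF G] P by (metis matrix_mul_assoc proj_mat_def)
  moreover have "G - G ** P = mat 1 - P"
    using G by (simp add: block_def matrix_diff_ldistrib)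
  ultimately show ?thesis by (simp add: algebra_simps)
qed

text \<open>The point u = 0 bounds the centre. A column of G is a difference of two vectors of norm
  at most D plus the complementary part of a unit vector, whence 2 D + 1. The bounds do not involve
  P, so they hold for all subspaces at once.\<close>

lemma inscribed_bounded:
  fixes P :: "real^'n^'n"
  assumes P: "proj_mat P" and K: "K \<subseteq> cball 0 D" and z: "(c, G) \<in> inscribed P K"
  shows "norm c \<le> D" "norm G \<le> real (CARD('n) * CARD('n)) * (2 * D + 1)"
proof -
  have in_K: "norm (c + G *v (P *v u)) \<le> D" if "norm u \<le> 1" for u
  proof -
    have "c + G *v (P *v u) \<in> K"
      using z that by (simp add: inscribed_def)
    then show ?thesis using K mem_cball_0 by blast
  qed
  from in_K[of 0] show c: "norm c \<le> D" by simp
  have tri: "norm (a - b + d) \<le> norm a + norm b + norm d" for a b d :: "real^'n"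
    by norm
  have "\<bar>G $ i $ j\<bar> \<le> 2 * D + 1" for i j
  proof -
    let ?u = "axis j 1 :: real^'n"
    have "block P G" using z by (simp add: inscribed_def)
    then have "G *v ?u = (c + G *v (P *v ?u)) - c + (?u - P *v ?u)"
      using block_apply[of P G ?u] by simp
    then have "norm (G *v ?u) \<le> norm (c + G *v (P *v ?u)) + norm c + norm (?u - P *v ?u)"
      using tri by metis
    also have "\<dots> \<le> D + D + 1"
      using in_K[of ?u] c norm_complement_le[OF P, of ?u] by simp
    finally have "\<bar>(G *v ?u) $ i\<bar> \<le> 2 * D + 1"
      using component_le_norm_cart[of "G *v ?u" i] by linarith
    moreover have "(G *v ?u) $ i = G $ i $ j"
      by (simp add: matrix_vector_mul_component inner_axis)
    ultimately show ?thesis by simp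
  qed
  then show "norm G \<le> real (CARD('n) * CARD('n)) * (2 * D + 1)"
    by (rule norm_matrix_le)
qed

text \<open>All the conditions are closed in P, c and G jointly. A constant sequence P gives
  closedness of the set of candidates; a varying one is needed for continuity.\<close>

lemma inscribed_limit:
  assumes K: "closed K" and "P \<longlonglongrightarrow> P'" "c \<longlonglongrightarrow> c'" "G \<longlonglongrightarrow> G'"
    and "\<And>j. (c j, G j) \<in> inscribed (P j) K"
  shows "(c', G') \<in> inscribed P' K"
proof -
  have j: "P j *v c j = c j" "G j ** (mat 1 - P j) = mat 1 - P j" "(mat 1 - P j) ** G j = mat 1 - P j"
      "\<And>u. norm u \<le> 1 \<Longrightarrow> c j + G j *v (P j *v u) \<in> K" for j
    using assms(5)[of j] by (auto simp: inscribed_def block_def)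
  have "(\<lambda>j. P j *v c j) \<longlonglongrightarrow> P' *v c'" using assms by (intro tendsto_intros)
  then have 1: "P' *v c' = c'" using assms(3) LIMSEQ_unique by (simp add: j) blast
  have R: "(\<lambda>j. mat 1 - P j) \<longlonglongrightarrow> mat 1 - P'" using assms by (intro tendsto_intros)
  have "(\<lambda>j. G j ** (mat 1 - P j)) \<longlonglongrightarrow> G' ** (mat 1 - P')"
      "(\<lambda>j. (mat 1 - P j) ** G j) \<longlonglongrightarrow> (mat 1 - P') ** G'"
    using assms by (intro tendsto_intros; simp)+
  then have 2: "block P' G'"
    using R LIMSEQ_unique by (simp add: j block_def) blast
  have "c' + G' *v (P' *v u) \<in> K" if "norm u \<le> 1" for u
  proof (rule closed_sequentially[OF K])
    show "c j + G j *v (P j *v u) \<in> K" for j using j that by blast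
    show "(\<lambda>j. c j + G j *v (P j *v u)) \<longlonglongrightarrow> c' + G' *v (P' *v u)"
      using assms by (intro tendsto_intros)
  qed
  with 1 2 show ?thesis by (simp add: inscribed_def)
qed

lemma max_inscribed_exists:
  fixes P :: "real^'n^'n"
  assumes P: "proj_mat P" and K: "compact K" "cball 0 e \<subseteq> K" "0 < e"
  shows "\<exists>z. max_inscribed P K z" "max_inscribed P K z \<Longrightarrow> det (snd z) \<noteq> 0"
proof -
  obtain D where D: "K \<subseteq> cball 0 D"
    using compact_imp_bounded[OF K(1)] by (force simp: bounded_iff)
  let ?I = "inscribed P K"
  have "bounded ?I"
  proof (rule bounded_subset)
    show "bounded (cball (0::real^'n) D \<times> cball (0::real^'n^'n) (real (CARD('n) * CARD('n)) * (2 * D + 1)))"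
      by (intro bounded_Times bounded_cball)
    show "?I \<subseteq> cball 0 D \<times> cball 0 (real (CARD('n) * CARD('n)) * (2 * D + 1))"
      using inscribed_bounded[OF P D] by auto
  qed
  moreover have "closed ?I"
    unfolding closed_sequential_limits
  proof safe
    fix z c G assume z: "\<forall>n. z n \<in> ?I" "z \<longlonglongrightarrow> (c, G)"
    show "(c, G) \<in> ?I"
    proof (rule inscribed_limit)
      show "closed K" using K(1) by (rule compact_imp_closed)
      show "(\<lambda>n. fst (z n)) \<longlonglongrightarrow> c" "(\<lambda>n. snd (z n)) \<longlonglongrightarrow> G"
        using tendsto_fst[OF z(2)] tendsto_snd[OF z(2)] by simp_all
      show "(\<lambda>n. P) \<longlonglongrightarrow> P" by simp
      show "(fst (z n), snd (z n)) \<in> ?I" for n using z(1) by simp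
    qed
  qed
  ultimately have "compact ?I" by (simp add: compact_eq_bounded_closed)
  \<comment> \<open>The ball of radius e in the range of P, as a block matrix: e on the range, 1 on
    the complement. It is a nonsingular candidate, so the maximal determinant is not 0.\<close>
  define G0 where "G0 = e *\<^sub>R (P ** mat 1 ** P) + (mat 1 - P)"
  have "G0 ** P = e *\<^sub>R P"
    using P by (simp add: G0_def proj_mat_def matrix_distribs)
  then have G0P: "G0 *v (P *v u) = e *\<^sub>R (P *v u)" for u
    by (simp add: matrix_vector_mul_assoc scaleR_matrix_vector_assoc)
  have "block P G0" unfolding G0_def by (rule block_of_proj[OF P])
  moreover have "e *\<^sub>R (P *v u) \<in> K" if "norm u \<le> 1" for u
    using K(2,3) norm_proj_mat_le[OF P, of u] that by (intro subsetD[OF K(2)]) (simp add: mult_left_le)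
  ultimately have G0: "(0, G0) \<in> ?I"
    by (simp add: inscribed_def G0P)
  have "inj ((*v) G0)"
  proof (rule linear_injective_0[THEN iffD2]; safe?)
    show "linear ((*v) G0)" by simp
    fix u assume u: "G0 *v u = 0"
    have "P *v (G0 *v u) = e *\<^sub>R (P *v u)"
      using block_apply_proj[OF \<open>block P G0\<close>] G0P by simp
    with u K(3) have "P *v u = 0" by simp
    with u show "u = 0" using block_apply[OF \<open>block P G0\<close>, of u] by simp
  qed
  then have "det G0 \<noteq> 0"
    by (simp add: det_nz_iff_inj[of "(*v) G0", simplified])
  have "continuous_on ?I (\<lambda>z. \<bar>det (snd z)\<bar>)"
    unfolding continuous_on_def by (intro ballI tendsto_intros)
  then obtain y where "y \<in> ?I" "\<And>z'. z' \<in> ?I \<Longrightarrow> \<bar>det (snd z')\<bar> \<le> \<bar>det (snd y)\<bar>"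
    using continuous_attains_sup[OF \<open>compact ?I\<close>] G0 by blast
  then show "\<exists>z. max_inscribed P K z" unfolding max_inscribed_def by blast
  assume "max_inscribed P K z"
  then have "\<bar>det (snd (0 :: real^'n, G0))\<bar> \<le> \<bar>det (snd z)\<bar>"
    using G0 unfolding max_inscribed_def by blast
  then show "det (snd z) \<noteq> 0"
    using \<open>det G0 \<noteq> 0\<close> by auto
qed

text \<open>Shrinking towards the interior point \<open>0\<close> by a factor $t < 1$ makes room for the perturbation of
  the subspace.\<close>

lemma eventually_inscribed:
  fixes P :: "nat \<Rightarrow> real^'n^'n"
  assumes K: "convex K" "cball 0 e \<subseteq> K" "0 < e" and P: "\<And>j. proj_mat (P j)" "P \<longlonglongrightarrow> P'" "proj_mat P'"
    and in': "(c, G) \<in> inscribed P' K" and t: "0 < t" "t < 1"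
  shows "\<forall>\<^sub>F j in sequentially. (t *\<^sub>R (P j *v c), t *\<^sub>R (P j ** G ** P j) + (mat 1 - P j)) \<in> inscribed (P j) K"
proof -
  have c: "P' *v c = c" and G: "block P' G" and K': "\<And>u. norm u \<le> 1 \<Longrightarrow> c + G *v (P' *v u) \<in> K"
    using in' by (auto simp: inscribed_def)
  have PGP: "P' ** G ** P' = G ** P'"
    using block_commute[OF G] P(3) by (metis matrix_mul_assoc proj_mat_def)
  \<comment> \<open>Bounds, for all u in the unit ball at once, how far a point of the ellipsoid
    moves when c and G are carried over from P' to \<open>P j\<close>.\<close>
  define \<delta> where "\<delta> = (\<lambda>j. norm (P j *v c - c) + norm (P j ** G ** P j - P' ** G ** P'))"
  have "(\<lambda>j. norm (P j *v c - c) + norm (P j ** G ** P j - P' ** G ** P'))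
      \<longlonglongrightarrow> norm (P' *v c - c) + norm (P' ** G ** P' - P' ** G ** P')"
    using P(2) by (intro tendsto_intros)
  then have "\<delta> \<longlonglongrightarrow> 0" by (simp add: \<delta>_def c)
  \<comment> \<open>A displacement d of at most this size is absorbed by the shrinking: t (w + d) is
    the combination of w and (t / (1 - t)) d with weights t and 1 - t, and the latter point has norm
    at most e.\<close>
  moreover have "0 < (1 - t) / t * e" using t K(3) by simp
  ultimately have "\<forall>\<^sub>F j in sequentially. \<delta> j < (1 - t) / t * e"
    by (rule order_tendstoD)
  then show ?thesis
  proof eventually_elim
    case (elim j)
    let ?G = "t *\<^sub>R (P j ** G ** P j) + (mat 1 - P j)"
    have PP: "P j ** P j = P j" using P(1) by (simp add: proj_mat_def)
    have "t *\<^sub>R (P j *v c) + ?G *v (P j *v u) \<in> K" if u: "norm u \<le> 1" for u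
    proof -
      define w where "w = c + G *v (P' *v u)"
      define d where "d = (P j *v c - c) + (P j ** G ** P j - P' ** G ** P') *v u"
      have "norm d \<le> norm (P j *v c - c) + norm (P j ** G ** P j - P' ** G ** P') * norm u"
        unfolding d_def using norm_matrix_vector_mult_le by (metis add_left_mono norm_triangle_le)
      also have "\<dots> \<le> \<delta> j"
        using u by (auto simp: \<delta>_def mult_left_le)
      finally have d: "norm d \<le> (1 - t) / t * e" using elim by simp
      have "norm ((t / (1 - t)) *\<^sub>R d) = t / (1 - t) * norm d"
        using t by simp
      also have "\<dots> \<le> t / (1 - t) * ((1 - t) / t * e)"
        using t d by (intro mult_left_mono) auto
      also have "\<dots> = e" using t by simp
      finally have d_K: "(t / (1 - t)) *\<^sub>R d \<in> K" using K(2) by auto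
      have "?G ** P j = t *\<^sub>R (P j ** G ** P j)"
        using PP by (simp add: matrix_distribs) (simp add: matrix_mul_assoc[symmetric])
      then have "?G *v (P j *v u) = t *\<^sub>R ((P j ** G ** P j) *v u)"
        by (simp add: matrix_vector_mul_assoc scaleR_matrix_vector_assoc)
      moreover have "w + d = P j *v c + (P j ** G ** P j) *v u"
        by (simp add: w_def d_def PGP matrix_vector_mult_diff_rdistrib matrix_vector_mul_assoc)
      ultimately have "t *\<^sub>R (P j *v c) + ?G *v (P j *v u) = t *\<^sub>R (w + d)"
        by (simp add: scaleR_right_distrib)
      also have "\<dots> = t *\<^sub>R w + (1 - t) *\<^sub>R ((t / (1 - t)) *\<^sub>R d)"
        using t by (simp add: scaleR_right_distrib)
      also have "\<dots> \<in> K"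
        using d_K K'[OF u] t by (intro convexD[OF K(1)]) (auto simp: w_def)
      finally show ?thesis .
    qed
    then show ?case
      using block_of_proj[OF P(1)] P(1) by (simp add: inscribed_def matrix_vector_mult_scaleR)
  qed
qed

text \<open>Any candidate for P', shrunk by t < 1 and carried over to \<open>P j\<close>, eventually
  competes with the maximizers there. Passing to the limit in j and then letting t increase to 1
  bounds its determinant by that of G'.\<close>

lemma max_inscribed_limit:
  fixes P :: "nat \<Rightarrow> real^'n^'n"
  assumes K: "convex K" "compact K" "cball 0 e \<subseteq> K" "0 < e"
    and P: "\<And>j. proj_mat (P j)" "P \<longlonglongrightarrow> P'" "proj_mat P'"
    and z: "\<And>j. max_inscribed (P j) K (c j, G j)" "c \<longlonglongrightarrow> c'" "G \<longlonglongrightarrow> G'"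
  shows "max_inscribed P' K (c', G')"
  unfolding max_inscribed_def
proof safe
  show "(c', G') \<in> inscribed P' K"
    using inscribed_limit[OF compact_imp_closed[OF K(2)] P(2) z(2,3)] z(1)
    by (auto simp: max_inscribed_def)
  fix c0 G0 assume in0: "(c0, G0) \<in> inscribed P' K"
  have bound: "\<bar>det (t *\<^sub>R (P' ** G0 ** P') + (mat 1 - P'))\<bar> \<le> \<bar>det G'\<bar>" if t: "0 < t" "t < 1" for t
  proof (rule tendsto_le)
    show "(\<lambda>j. \<bar>det (G j)\<bar>) \<longlonglongrightarrow> \<bar>det G'\<bar>"
      using z by (intro tendsto_intros)
    show "(\<lambda>j. \<bar>det (t *\<^sub>R (P j ** G0 ** P j) + (mat 1 - P j))\<bar>)
        \<longlonglongrightarrow> \<bar>det (t *\<^sub>R (P' ** G0 ** P') + (mat 1 - P'))\<bar>"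
      using P(2) by (intro tendsto_intros)
    show "\<forall>\<^sub>F j in sequentially. \<bar>det (t *\<^sub>R (P j ** G0 ** P j) + (mat 1 - P j))\<bar> \<le> \<bar>det (G j)\<bar>"
      using eventually_inscribed[OF K(1,3,4) P in0 t]
    proof eventually_elim
      case (elim j)
      then show ?case using z(1)[of j] by (force simp: max_inscribed_def)
    qed
  qed simp
  have "\<bar>det (1 *\<^sub>R (P' ** G0 ** P') + (mat 1 - P'))\<bar> \<le> \<bar>det G'\<bar>"
  proof (rule tendsto_upperbound)
    show "((\<lambda>t. \<bar>det (t *\<^sub>R (P' ** G0 ** P') + (mat 1 - P'))\<bar>)
        \<longlongrightarrow> \<bar>det (1 *\<^sub>R (P' ** G0 ** P') + (mat 1 - P'))\<bar>) (at_left 1)"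
      by (intro tendsto_intros)
    show "\<forall>\<^sub>F t in at_left 1. \<bar>det (t *\<^sub>R (P' ** G0 ** P') + (mat 1 - P'))\<bar> \<le> \<bar>det G'\<bar>"
      unfolding eventually_at_left_field using bound by (intro exI[of _ 0]) auto
  qed simp
  then show "\<bar>det (snd (c0, G0))\<bar> \<le> \<bar>det (snd (c', G'))\<bar>"
    using block_eq[OF P(3)] in0 by (simp add: inscribed_def)
qed

text \<open>Different \<open>G\<close> give the same ellipsoid, but $G G^T$ is determined by it.\<close>

definition john_form :: "(real^'n) set \<Rightarrow> real^'n^'n \<Rightarrow> real^'n^'n"
  where "john_form K P = (let G = snd (SOME z. max_inscribed P K z) in G ** transpose G)"

text \<open>Uniqueness makes the choice behind \<open>john_form\<close> immaterial: any maximizer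
  computes it.\<close>

lemma john_form_eq:
  assumes "proj_mat P" "convex K" "compact K" "cball 0 e \<subseteq> K" "0 < e" "max_inscribed P K (c, G)"
  shows "john_form K P = G ** transpose G"
proof -
  obtain c' G' where *: "(SOME z. max_inscribed P K z) = (c', G')" by fastforce
  have "max_inscribed P K (c', G')"
    using assms(6) someI[of "max_inscribed P K"] by (metis *)
  then show ?thesis
    using max_inscribed_unique[OF assms(1,2) assms(6)] max_inscribed_exists(2)[OF assms(1,3,4,5,6)]
    by (auto simp: john_form_def *)
qed

lemma closed_proj_mat: "closed {P. proj_mat P}"
  unfolding closed_sequential_limits
proof safe
  fix P :: "nat \<Rightarrow> real^'n^'n" and P' assume P: "\<forall>j. P j \<in> {P. proj_mat P}" "P \<longlonglongrightarrow> P'"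
  have "(\<lambda>j. transpose (P j)) \<longlonglongrightarrow> transpose P'" "(\<lambda>j. P j ** P j) \<longlonglongrightarrow> P' ** P'"
    using P(2) by (intro tendsto_intros; simp)+
  then show "proj_mat P'"
    using P LIMSEQ_unique by (simp add: proj_mat_def) blast
qed

text \<open>The chosen maximizers need not vary continuously, but the form takes values in a compact
  set, so a closed graph suffices. Along a convergent sequence in the graph, a subsequence of
  maximizers converges; its limit is again a maximizer, and by uniqueness its form is the value at
  the limit.\<close>

lemma continuous_on_john_form:
  fixes K :: "(real^'n) set"
  assumes K: "convex K" "compact K" "cball 0 e \<subseteq> K" "0 < e"
  shows "continuous_on {P. proj_mat P} (john_form K)"
proof -
  obtain D where D: "K \<subseteq> cball 0 D"
    using compact_imp_bounded[OF K(2)] by (force simp: bounded_iff)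
  define b where "b = real (CARD('n) * CARD('n)) * (2 * D + 1)"
  define J where "J = (\<lambda>P. SOME z. max_inscribed P K z)"
  have J: "max_inscribed P K (J P)" if "proj_mat P" for P
    unfolding J_def using max_inscribed_exists(1)[OF that K(2-4)] by (rule someI_ex)
  have form: "john_form K P = snd (J P) ** transpose (snd (J P))" for P
    by (simp add: john_form_def J_def Let_def)
  let ?T = "cball (0::real^'n) D \<times> cball (0::real^'n^'n) b"
  have JT: "J P \<in> ?T" if "proj_mat P" for P
    using inscribed_bounded[OF that D, of "fst (J P)" "snd (J P)"] J[OF that]
    by (cases "J P") (simp add: max_inscribed_def b_def)
  have T: "compact ?T" by (intro compact_Times compact_cball)
  show ?thesis
  proof (rule continuous_from_closed_graph)
    show "compact ((\<lambda>z. snd z ** transpose (snd z)) ` ?T)"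
      using T by (rule compact_continuous_image[rotated])
        (unfold continuous_on_def, intro ballI tendsto_intros)
    show "john_form K \<in> {P. proj_mat P} \<rightarrow> (\<lambda>z. snd z ** transpose (snd z)) ` ?T"
      using JT form by blast
    show "closed ((\<lambda>P. (P, john_form K P)) ` {P. proj_mat P})"
      unfolding closed_sequential_limits
    proof safe
      fix x P' h
      assume graph: "\<forall>j. x j \<in> (\<lambda>P. (P, john_form K P)) ` {P. proj_mat P}" and lim: "x \<longlonglongrightarrow> (P', h)"
      have x: "proj_mat (fst (x j))" "snd (x j) = john_form K (fst (x j))" for j
        using graph[rule_format, of j] by auto
      define P where "P = (\<lambda>j. fst (x j))"
      have P: "proj_mat (P j)" for j using x by (simp add: P_def)
      have limP: "P \<longlonglongrightarrow> P'" and limh: "(\<lambda>j. john_form K (P j)) \<longlonglongrightarrow> h"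
        using tendsto_fst[OF lim] tendsto_snd[OF lim] x by (simp_all add: P_def)
      have P': "proj_mat P'"
        using closed_sequentially[OF closed_proj_mat _ limP] P by simp
      obtain z r where z: "strict_mono r" "((\<lambda>j. J (P j)) \<circ> r) \<longlonglongrightarrow> z"
        using T JT[OF P] unfolding compact_def by (metis (no_types, lifting))
      have c: "(\<lambda>j. fst (J (P (r j)))) \<longlonglongrightarrow> fst z" and G: "(\<lambda>j. snd (J (P (r j)))) \<longlonglongrightarrow> snd z"
        using tendsto_fst[OF z(2)] tendsto_snd[OF z(2)] by (simp_all only: o_def)
      have "max_inscribed P' K (fst z, snd z)"
      proof (rule max_inscribed_limit[OF K])
        show "(\<lambda>j. P (r j)) \<longlonglongrightarrow> P'"
          using LIMSEQ_subseq_LIMSEQ[OF limP z(1)] by (simp add: o_def)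
        show "max_inscribed (P (r j)) K (fst (J (P (r j))), snd (J (P (r j))))" for j
          using J[OF P] by simp
      qed (use P P' c G in auto)
      then have "john_form K P' = snd z ** transpose (snd z)"
        by (rule john_form_eq[OF P' K])
      moreover have "(\<lambda>j. john_form K (P (r j))) \<longlonglongrightarrow> snd z ** transpose (snd z)"
        unfolding form by (intro tendsto_matrix_matrix_mult tendsto_transpose G)
      moreover have "(\<lambda>j. john_form K (P (r j))) \<longlonglongrightarrow> h"
        using LIMSEQ_subseq_LIMSEQ[OF limh z(1)] by (simp add: o_def)
      ultimately have "h = john_form K P'"
        using LIMSEQ_unique by metis
      with P' show "(P', h) \<in> (\<lambda>P. (P, john_form K P)) ` {P. proj_mat P}" by blast
    qed
  qed
qed

section \<open>Volume in an affine subspace as a multiple of the determinant\<close>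

lemma emeasure_PiM_prefix_cube:
  fixes k n :: nat
  assumes "k \<le> n" and A: "A \<in> sets (Pi\<^sub>M {..<k} (\<lambda>_. lborel :: real measure))"
  shows "emeasure (Pi\<^sub>M {..<n} (\<lambda>_. lborel :: real measure))
      {t \<in> {..<n} \<rightarrow>\<^sub>E UNIV. restrict t {..<k} \<in> A \<and> (\<forall>i\<in>{k..<n}. t i \<in> {0..1})}
    = emeasure (Pi\<^sub>M {..<k} (\<lambda>_. lborel)) A"
proof -
  interpret product_sigma_finite "\<lambda>_::nat. lborel :: real measure" ..
  interpret I: finite_product_sigma_finite "\<lambda>_::nat. lborel :: real measure" "{..<k}" by standard simp
  interpret J: finite_product_sigma_finite "\<lambda>_::nat. lborel :: real measure" "{k..<n}" by standard simp
  interpret N: finite_product_sigma_finite "\<lambda>_::nat. lborel :: real measure" "{..<n}" by standard simp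
  let ?C = "\<Pi>\<^sub>E i\<in>{k..<n}. {0..1::real}"
  let ?S = "{t \<in> {..<n} \<rightarrow>\<^sub>E UNIV. restrict t {..<k} \<in> A \<and> (\<forall>i\<in>{k..<n}. t i \<in> {0..1})}"
  have n: "{..<k} \<union> {k..<n} = {..<n}" using \<open>k \<le> n\<close> by auto
  have C: "?C \<in> sets (Pi\<^sub>M {k..<n} (\<lambda>_. lborel :: real measure))"
    by (intro sets_PiM_I_finite) auto
  have A_sub: "A \<subseteq> {..<k} \<rightarrow>\<^sub>E UNIV" using sets.sets_into_space[OF A] by (simp add: space_PiM)
  have S: "?S \<in> sets (Pi\<^sub>M {..<n} (\<lambda>_. lborel :: real measure))"
  proof -
    have 1: "(\<lambda>t. restrict t {..<k}) -` A \<inter> space (Pi\<^sub>M {..<n} (\<lambda>_. lborel :: real measure))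
        \<in> sets (Pi\<^sub>M {..<n} (\<lambda>_. lborel :: real measure))"
      using \<open>k \<le> n\<close> A by (intro measurable_sets[OF measurable_restrict_subset]) auto
    have 2: "(\<lambda>t. restrict t {k..<n}) -` ?C \<inter> space (Pi\<^sub>M {..<n} (\<lambda>_. lborel :: real measure))
        \<in> sets (Pi\<^sub>M {..<n} (\<lambda>_. lborel :: real measure))"
      using C by (intro measurable_sets[OF measurable_restrict_subset]) auto
    have rC: "restrict t {k..<n} \<in> ?C \<longleftrightarrow> (\<forall>i\<in>{k..<n}. t i \<in> {0..1})" for t
      by (simp add: PiE_iff)
    have "?S = ((\<lambda>t. restrict t {..<k}) -` A \<inter> space (Pi\<^sub>M {..<n} (\<lambda>_. lborel :: real measure)))
        \<inter> ((\<lambda>t. restrict t {k..<n}) -` ?C \<inter> space (Pi\<^sub>M {..<n} (\<lambda>_. lborel :: real measure)))"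
      by (auto simp: space_PiM rC Pi_iff)
    then show ?thesis using 1 2 by simp
  qed
  \<comment> \<open>Splitting the first k coordinates from the others turns the set into a product
    of A with a unit cube, and the cube has measure 1.\<close>
  have "emeasure (Pi\<^sub>M {..<n} (\<lambda>_. lborel)) ?S
      = emeasure (distr (Pi\<^sub>M {..<k} (\<lambda>_. lborel) \<Otimes>\<^sub>M Pi\<^sub>M {k..<n} (\<lambda>_. lborel))
          (Pi\<^sub>M ({..<k} \<union> {k..<n}) (\<lambda>_. lborel)) (merge {..<k} {k..<n})) ?S"
    by (subst distr_merge) (auto simp: n)
  also have "\<dots> = emeasure (Pi\<^sub>M {..<k} (\<lambda>_. lborel) \<Otimes>\<^sub>M Pi\<^sub>M {k..<n} (\<lambda>_. lborel))
      (merge {..<k} {k..<n} -` ?S \<inter> space (Pi\<^sub>M {..<k} (\<lambda>_. lborel) \<Otimes>\<^sub>M Pi\<^sub>M {k..<n} (\<lambda>_. lborel)))"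
    using S by (intro emeasure_distr measurable_merge) (simp add: n)
  also have "merge {..<k} {k..<n} -` ?S \<inter> space (Pi\<^sub>M {..<k} (\<lambda>_. lborel) \<Otimes>\<^sub>M Pi\<^sub>M {k..<n} (\<lambda>_. lborel :: real measure))
      = A \<times> ?C" (is "?V = _")
  proof (rule set_eqI, clarify)
    fix s t :: "nat \<Rightarrow> real"
    have r: "restrict (merge {..<k} {k..<n} (s, t)) {..<k} = s" if "s \<in> {..<k} \<rightarrow>\<^sub>E UNIV"
      using that by (auto simp: merge_def restrict_def PiE_iff extensional_def fun_eq_iff)
    have m: "merge {..<k} {k..<n} (s, t) \<in> {..<n} \<rightarrow>\<^sub>E UNIV"
      using \<open>k \<le> n\<close> by (auto simp: merge_def PiE_iff extensional_def)
    have c: "(\<forall>i\<in>{k..<n}. merge {..<k} {k..<n} (s, t) i \<in> {0..1}) \<longleftrightarrow> (\<forall>i\<in>{k..<n}. t i \<in> {0..1})"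
      by (intro ball_cong) (auto simp: merge_def)
    have "(s, t) \<in> ?V \<longleftrightarrow> merge {..<k} {k..<n} (s, t) \<in> ?S \<and> s \<in> {..<k} \<rightarrow>\<^sub>E UNIV \<and> t \<in> {k..<n} \<rightarrow>\<^sub>E UNIV"
      by (simp add: space_pair_measure space_PiM)
    also have "\<dots> \<longleftrightarrow> s \<in> A \<and> t \<in> ?C"
      using r m c A_sub by (auto simp: PiE_iff subset_eq)
    finally show "(s, t) \<in> ?V \<longleftrightarrow> (s, t) \<in> A \<times> ?C" by simp
  qed
  also have "emeasure (Pi\<^sub>M {..<k} (\<lambda>_. lborel) \<Otimes>\<^sub>M Pi\<^sub>M {k..<n} (\<lambda>_. lborel)) (A \<times> ?C)
      = emeasure (Pi\<^sub>M {..<k} (\<lambda>_. lborel)) A * emeasure (Pi\<^sub>M {k..<n} (\<lambda>_. lborel)) ?C"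
    using A C by (rule J.emeasure_pair_measure_Times)
  also have "emeasure (Pi\<^sub>M {k..<n} (\<lambda>_. lborel :: real measure)) ?C = 1"
    by (subst emeasure_PiM) auto
  finally show ?thesis by (simp only: mult_1_right)
qed

lemma orthonormal_expansion:
  fixes e :: "nat \<Rightarrow> real^'n"
  assumes e: "\<And>i j. i < CARD('n) \<Longrightarrow> j < CARD('n) \<Longrightarrow> e i \<bullet> e j = of_bool (i = j)"
  shows "(\<Sum>i<CARD('n). (y \<bullet> e i) *\<^sub>R e i) = y"
proof -
  let ?E = "e ` {..<CARD('n)}"
  have inj: "inj_on e {..<CARD('n)}" and E: "pairwise orthogonal ?E" "0 \<notin> ?E"
    by (rule orthonormal_family[of "CARD('n)" e], rule e; assumption)+
  have "independent ?E" using E by (rule pairwise_orthogonal_independent)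
  moreover have "card ?E = CARD('n)" using inj by (simp add: card_image)
  ultimately have span: "UNIV \<subseteq> span ?E"
    by (intro card_ge_dim_independent) simp_all
  let ?d = "y - (\<Sum>i<CARD('n). (y \<bullet> e i) *\<^sub>R e i)"
  have "?d \<bullet> e j = 0" if "j < CARD('n)" for j
  proof -
    have "(\<Sum>i<CARD('n). (y \<bullet> e i) *\<^sub>R e i) \<bullet> e j = (\<Sum>i<CARD('n). if i = j then y \<bullet> e i else 0)"
      unfolding inner_sum_left using e that by (intro sum.cong) auto
    then show ?thesis using that by (simp add: inner_diff_left)
  qed
  then have "orthogonal ?d ?d"
    using span by (intro orthogonal_to_span[of ?d ?E]) (auto simp: orthogonal_def)
  then show ?thesis by (simp add: orthogonal_def)
qed

text \<open>Thickening the ellipsoid by the unit cube of the orthogonal complement, which \<open>G\<close> fixes, turns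
  its \<open>k\<close>-dimensional volume into an \<open>n\<close>-dimensional one.\<close>

lemma affine_volume_block_image:
  fixes P :: "real^'n^'n" and x :: "real^'n"
  assumes P: "proj_mat P" and W_def: "W = {y. P *v y = y}" and L_def: "L = (+) x ` W"
  shows "\<exists>\<kappa>>0. \<forall>c\<in>L. \<forall>G. block P G \<longrightarrow>
    affine_volume L ((\<lambda>u. c + G *v u) ` (W \<inter> cball 0 1)) = \<kappa> * \<bar>det G\<bar>"
proof -
  let ?n = "CARD('n)"
  have W: "subspace W"
    by (auto simp: W_def subspace_def matrix_vector_right_distrib matrix_vector_mult_scaleR)
  have "affine L" "L \<noteq> {}"
    using W subspace_0[OF W] by (auto simp: L_def subspace_imp_affine affine_translation[symmetric])
  define k where "k = nat (aff_dim L)"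
  obtain p e where fr: "(SOME fr. orthonormal_frame L fr) = (p, e)" by fastforce
  have frame: "orthonormal_frame L (p, e)"
    using orthonormal_frame_exists[OF \<open>affine L\<close> \<open>L \<noteq> {}\<close>] someI_ex[of "orthonormal_frame L"] by (simp add: fr)
  then have e: "\<And>i j. i < k \<Longrightarrow> j < k \<Longrightarrow> e i \<bullet> e j = of_bool (i = j)"
    and L: "L = {p + (\<Sum>i<k. t i *\<^sub>R e i) | t. True}"
    unfolding orthonormal_frame_def prod.case Let_def k_def by blast+
  obtain e' where "k \<le> ?n" and e'e: "\<And>i. i < k \<Longrightarrow> e' i = e i"
    and e': "\<And>i j. i < ?n \<Longrightarrow> j < ?n \<Longrightarrow> e' i \<bullet> e' j = of_bool (i = j)"
    by (rule orthonormal_list_extend[OF e]) blast+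
  have L_mem: "p + (\<Sum>i<k. t i *\<^sub>R e i) \<in> L" for t
    unfolding L by blast
  from L_mem[of "\<lambda>_. 0"] have "p \<in> L" by simp
  have Lx: "y \<in> L \<longleftrightarrow> y - x \<in> W" for y
    unfolding L_def by (auto intro: image_eqI[of _ _ "y - x"])
  have Lp: "y \<in> L \<longleftrightarrow> y - p \<in> W" for y
  proof -
    have "p - x \<in> W" using \<open>p \<in> L\<close> Lx by simp
    then show ?thesis
      using subspace_add[OF W, of "y - p" "p - x"] subspace_diff[OF W, of "y - x" "p - x"] Lx by auto
  qed
  have We: "(\<Sum>i<k. t i *\<^sub>R e i) \<in> W" for t
    using Lp[of "p + (\<Sum>i<k. t i *\<^sub>R e i)"] L_mem by simp
  have eW: "P *v e i = e i" if "i < k" for i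
  proof -
    have "(\<Sum>j<k. of_bool (j = i) *\<^sub>R e j) = (\<Sum>j<k. if j = i then e j else 0)"
      by (intro sum.cong) auto
    then show ?thesis using We[of "\<lambda>j. of_bool (j = i)"] that by (simp add: W_def)
  qed
  \<comment> \<open>P maps the added vector into W, which is spanned by the first k vectors, and it
    is orthogonal to all of these. So the added vectors lie in the complement of W.\<close>
  have eJ: "P *v e' i = 0" if "i \<in> {k..<?n}" for i
  proof -
    have "P *v e' i \<in> W" using P by (simp add: W_def)
    then have "p + P *v e' i \<in> L" using Lp by simp
    then obtain t where t: "P *v e' i = (\<Sum>j<k. t j *\<^sub>R e j)" unfolding L by auto
    have "(P *v e' i) \<bullet> (P *v e' i) = e' i \<bullet> (P *v e' i)"
      using P by (simp add: proj_mat_inner)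
    also have "\<dots> = (\<Sum>j<k. t j * (e' i \<bullet> e' j))"
      unfolding t inner_sum_right using e'e by simp
    also have "\<dots> = 0" using e' that by (intro sum.neutral) auto
    finally show ?thesis by simp
  qed
  have PJ: "(P *v y) \<bullet> e' i = 0" if "i \<in> {k..<?n}" for y i
    using proj_mat_inner[OF P, of y "e' i"] eJ[OF that] by simp
  define \<Phi> where "\<Phi> = (\<lambda>t :: nat \<Rightarrow> real. \<Sum>i<?n. t i *\<^sub>R e' i)"
  have \<Phi>: "\<Phi> t = (\<Sum>i<k. t i *\<^sub>R e i) + (\<Sum>i\<in>{k..<?n}. t i *\<^sub>R e' i)" for t
  proof -
    have "{..<?n} = {..<k} \<union> {k..<?n}" using \<open>k \<le> ?n\<close> by auto
    moreover have "{..<k} \<inter> {k..<?n} = {}" by auto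
    ultimately have "\<Phi> t = (\<Sum>i<k. t i *\<^sub>R e' i) + (\<Sum>i\<in>{k..<?n}. t i *\<^sub>R e' i)"
      unfolding \<Phi>_def by (simp add: sum.union_disjoint)
    then show ?thesis using e'e by simp
  qed
  have P\<Phi>: "P *v \<Phi> t = (\<Sum>i<k. t i *\<^sub>R e i)" for t
  proof -
    have "P *v (\<Sum>i\<in>{k..<?n}. t i *\<^sub>R e' i) = (\<Sum>i\<in>{k..<?n}. t i *\<^sub>R (P *v e' i))"
      by (simp add: linear_sum[OF matrix_vector_mul_linear] matrix_vector_mult_scaleR)
    also have "\<dots> = 0" using eJ by simp
    finally show ?thesis
      using We[of t] by (simp add: \<Phi> W_def matrix_vector_right_distrib)
  qed
  have \<Phi>e: "\<Phi> t \<bullet> e' i = t i" if "i < ?n" for t i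
  proof -
    have "\<Phi> t \<bullet> e' i = (\<Sum>j<?n. if j = i then t j else 0)"
      unfolding \<Phi>_def inner_sum_left using e' that by (intro sum.cong) auto
    then show ?thesis using that by simp
  qed
  \<comment> \<open>The cylinder over the unit ball of W with the unit cube of the complement as its
    other factor. It involves neither c nor G, so its volume can serve as the constant.\<close>
  define D where "D = {z. norm (P *v z) \<le> 1 \<and> (\<forall>i\<in>{k..<?n}. 0 \<le> z \<bullet> e' i \<and> z \<bullet> e' i \<le> 1)}"
  have "norm z \<le> 1 + real (?n - k)" if "z \<in> D" for z
  proof -
    have z: "\<Phi> (\<lambda>i. z \<bullet> e' i) = z"
      unfolding \<Phi>_def by (rule orthonormal_expansion[OF e'])
    have "norm (\<Sum>i\<in>{k..<?n}. (z \<bullet> e' i) *\<^sub>R e' i) \<le> (\<Sum>i\<in>{k..<?n}. 1)"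
      using that e' by (intro sum_norm_le) (auto simp: D_def norm_eq_sqrt_inner)
    moreover have "z = P *v z + (\<Sum>i\<in>{k..<?n}. (z \<bullet> e' i) *\<^sub>R e' i)"
      using \<Phi>[of "\<lambda>i. z \<bullet> e' i"] P\<Phi>[of "\<lambda>i. z \<bullet> e' i"] z by simp
    then have "norm z \<le> norm (P *v z) + norm (\<Sum>i\<in>{k..<?n}. (z \<bullet> e' i) *\<^sub>R e' i)"
      by (metis norm_triangle_ineq)
    ultimately show ?thesis using that by (simp add: D_def)
  qed
  then have "bounded D" unfolding bounded_iff by blast
  moreover have "closed D"
  proof -
    have "D = {z. norm (P *v z) \<le> 1} \<inter> (\<Inter>i\<in>{k..<?n}. {z. 0 \<le> z \<bullet> e' i} \<inter> {z. z \<bullet> e' i \<le> 1})"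
      by (auto simp: D_def)
    then show ?thesis
      by (auto intro!: closed_Int closed_INT closed_Collect_le continuous_intros)
  qed
  ultimately have D: "compact D" by (simp add: compact_eq_bounded_closed)
  define \<kappa> where "\<kappa> = measure lebesgue D"
  have "\<kappa> > 0"
  proof (rule ccontr)
    assume "\<not> \<kappa> > 0"
    then have "\<kappa> = 0" by (simp add: \<kappa>_def not_less measure_le_0_iff)
    then have neg: "negligible D"
      using lmeasurable_compact[OF D] by (simp add: negligible_iff_measure \<kappa>_def)
    \<comment> \<open>The same cylinder with strict inequalities. It is open and contains the point
      with all coordinates 0 along W and 1/2 in the cube, so D cannot be negligible.\<close>
    define U where "U = {z. norm (P *v z) < 1} \<inter> (\<Inter>i\<in>{k..<?n}. {z. 0 < z \<bullet> e' i} \<inter> {z. z \<bullet> e' i < 1})"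
    have "open U"
      unfolding U_def by (auto intro!: open_Int open_INT open_Collect_less continuous_intros)
    moreover have "\<Phi> (\<lambda>i. if i < k then 0 else 1/2) \<in> U"
      using \<open>k \<le> ?n\<close> by (simp add: U_def P\<Phi> \<Phi>e)
    then have "U \<noteq> {}" by blast
    ultimately have "\<not> negligible U" by (rule open_not_negligible)
    moreover have "U \<subseteq> D" by (auto simp: U_def D_def less_imp_le)
    ultimately show False
      using neg negligible_subset by blast
  qed
  moreover have "affine_volume L ((\<lambda>u. c + G *v u) ` (W \<inter> cball 0 1)) = \<kappa> * \<bar>det G\<bar>"
    if c: "c \<in> L" and G: "block P G" for c G
  proof -
    let ?A = "(\<lambda>u. c + G *v u) ` (W \<inter> cball 0 1)"
    let ?M = "(\<lambda>z. (c - p) + G *v z) ` D"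
    have cp: "P *v (c - p) = c - p" using c Lp by (simp add: W_def)
    \<comment> \<open>Because G preserves W and is the identity on the complement, the image of the
      cylinder is the thickened ellipsoid: the component in W ranges over the ellipsoid and the cube
      coordinates are unchanged. For the converse the preimage of y keeps the complementary part of
      y.\<close>
    have M: "y \<in> ?M \<longleftrightarrow> p + P *v y \<in> ?A \<and> (\<forall>i\<in>{k..<?n}. 0 \<le> y \<bullet> e' i \<and> y \<bullet> e' i \<le> 1)" for y
    proof
      assume "y \<in> ?M"
      then obtain z where z: "z \<in> D" "y = (c - p) + G *v z" by blast
      have "p + P *v y = c + G *v (P *v z)"
        using cp block_apply_proj[OF G] by (simp add: z(2) matrix_vector_right_distrib)
      moreover have "P *v z \<in> W \<inter> cball 0 1" using z(1) P by (simp add: W_def D_def)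
      moreover have "y \<bullet> e' i = z \<bullet> e' i" if "i \<in> {k..<?n}" for i
      proof -
        have "y = P *v (c - p) + P *v (G *v z) + (z - P *v z)"
          unfolding z(2) cp block_apply_proj[OF G] using block_apply[OF G, of z] by simp
        then show ?thesis
          using PJ[OF that] by (simp only: inner_add_left inner_diff_left)
      qed
      ultimately show "p + P *v y \<in> ?A \<and> (\<forall>i\<in>{k..<?n}. 0 \<le> y \<bullet> e' i \<and> y \<bullet> e' i \<le> 1)"
        using z(1) by (auto simp: D_def)
    next
      assume y: "p + P *v y \<in> ?A \<and> (\<forall>i\<in>{k..<?n}. 0 \<le> y \<bullet> e' i \<and> y \<bullet> e' i \<le> 1)"
      then obtain u where u: "P *v u = u" "norm u \<le> 1" "p + P *v y = c + G *v u"
        by (auto simp: W_def)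
      define z where "z = u + (y - P *v y)"
      have Pz: "P *v z = u"
        using P u(1) by (simp add: z_def matrix_vector_right_distrib matrix_vector_mult_diff_distrib)
      have "(c - p) + G *v z = y"
        using block_apply[OF G, of z] u(3) by (simp add: Pz) (simp add: z_def algebra_simps)
      moreover have "z \<bullet> e' i = y \<bullet> e' i" if "i \<in> {k..<?n}" for i
        using PJ[OF that, of y] PJ[OF that, of u] u(1) by (simp add: z_def inner_add_left inner_diff_left)
      then have "z \<in> D" using y u(2) by (simp add: D_def Pz)
      ultimately show "y \<in> ?M" by blast
    qed
    have "compact ?M"
      using D by (intro compact_continuous_image continuous_intros)
    have "?M = (+) (c - p) ` (*v) G ` D" by (simp add: image_image)
    then have "measure lebesgue ?M = measure lebesgue ((*v) G ` D)"
      by (simp only: measure_translation)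
    also have "\<dots> = \<bar>det G\<bar> * \<kappa>"
      using measure_linear_image_cart[of "(*v) G" D] lmeasurable_compact[OF D] by (simp add: \<kappa>_def)
    finally have measure_M: "measure lborel ?M = \<kappa> * \<bar>det G\<bar>"
      using \<open>compact ?M\<close> by (simp add: compact_imp_closed borel_closed)
    let ?X = "{t \<in> {..<k} \<rightarrow>\<^sub>E UNIV. p + (\<Sum>i<k. t i *\<^sub>R e i) \<in> ?A}"
    have "closed W" using W by (rule closed_subspace)
    then have "compact ?A"
      by (intro compact_continuous_image continuous_intros closed_Int_compact) auto
    have meas: "(\<lambda>t. p + (\<Sum>i<k. t i *\<^sub>R e i)) \<in> Pi\<^sub>M {..<k} (\<lambda>_. lborel :: real measure) \<rightarrow>\<^sub>M borel"
    proof (intro borel_measurable_add borel_measurable_const borel_measurable_sum borel_measurable_scaleR)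
      fix i assume "i \<in> {..<k}"
      then have "(\<lambda>t. t i) \<in> Pi\<^sub>M {..<k} (\<lambda>_. lborel :: real measure) \<rightarrow>\<^sub>M lborel"
        by (rule measurable_component_singleton)
      then show "(\<lambda>t. t i) \<in> borel_measurable (Pi\<^sub>M {..<k} (\<lambda>_. lborel :: real measure))" by simp
    qed
    have vimage: "(\<lambda>t. p + (\<Sum>i<k. t i *\<^sub>R e i)) -` B \<inter> space (Pi\<^sub>M {..<k} (\<lambda>_. lborel :: real measure))
        = {t \<in> {..<k} \<rightarrow>\<^sub>E UNIV. p + (\<Sum>i<k. t i *\<^sub>R e i) \<in> B}" for B
      by (auto simp: space_PiM)
    have "?A \<in> sets borel"
      using \<open>compact ?A\<close> by (intro borel_closed compact_imp_closed)
    from measurable_sets[OF meas this]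
    have A0: "?X \<in> sets (Pi\<^sub>M {..<k} (\<lambda>_. lborel :: real measure))"
      unfolding vimage .
    have "emeasure (Pi\<^sub>M {..<k} (\<lambda>_. lborel)) ?X
        = emeasure (Pi\<^sub>M {..<?n} (\<lambda>_. lborel :: real measure))
            {t \<in> {..<?n} \<rightarrow>\<^sub>E UNIV. restrict t {..<k} \<in> ?X \<and> (\<forall>i\<in>{k..<?n}. t i \<in> {0..1})}"
      by (rule emeasure_PiM_prefix_cube[OF \<open>k \<le> ?n\<close> A0, symmetric])
    also have "{t \<in> {..<?n} \<rightarrow>\<^sub>E UNIV. restrict t {..<k} \<in> ?X \<and> (\<forall>i\<in>{k..<?n}. t i \<in> {0..1})}
        = {t \<in> {..<?n} \<rightarrow>\<^sub>E UNIV. (\<Sum>i<?n. t i *\<^sub>R e' i) \<in> ?M}"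
    proof (intro Collect_cong conj_cong refl)
      fix t :: "nat \<Rightarrow> real"
      have "restrict t {..<k} \<in> ?X \<longleftrightarrow> p + (\<Sum>i<k. t i *\<^sub>R e i) \<in> ?A"
        by simp
      moreover have "(\<forall>i\<in>{k..<?n}. t i \<in> {0..1}) \<longleftrightarrow>
          (\<forall>i\<in>{k..<?n}. 0 \<le> \<Phi> t \<bullet> e' i \<and> \<Phi> t \<bullet> e' i \<le> 1)"
        using \<Phi>e by auto
      ultimately show "(restrict t {..<k} \<in> ?X \<and> (\<forall>i\<in>{k..<?n}. t i \<in> {0..1}))
          = ((\<Sum>i<?n. t i *\<^sub>R e' i) \<in> ?M)"
        using M[of "\<Phi> t"] unfolding P\<Phi> by (simp only: \<Phi>_def)
    qed
    also have "emeasure (Pi\<^sub>M {..<?n} (\<lambda>_. lborel)) \<dots> = emeasure lborel ?M"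
      by (rule emeasure_PiM_orthonormal_coordinates[OF e' \<open>compact ?M\<close>])
    finally have "measure (Pi\<^sub>M {..<k} (\<lambda>_. lborel)) ?X = measure lborel ?M"
      by (simp only: measure_def)
    then show ?thesis
      unfolding affine_volume_def fr measure_M k_def[symmetric] by (simp only: Let_def prod.case)
  qed
  ultimately show ?thesis by blast
qed

text \<open>The condition says that G / sqrt l is orthogonal on W. Polarization turns it into G G^T
  y = l y on W. Since G^T is injective, the nonzero vector \<open>y0\<close> forces l to be
  positive.\<close>

lemma block_image_ball:
  fixes P G :: "real^'n^'n"
  assumes P: "proj_mat P" and G: "block P G" and "det G \<noteq> 0" and W_def: "W = {y. P *v y = y}"
    and form: "\<And>y. y \<in> W \<Longrightarrow> y \<bullet> ((G ** transpose G) *v y) = l * (y \<bullet> y)"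
    and "y0 \<in> W" "y0 \<noteq> 0"
  shows "l > 0" "(*v) G ` (W \<inter> cball 0 1) = W \<inter> cball 0 (sqrt l)"
proof -
  let ?H = "G ** transpose G"
  have GT: "block P (transpose G)" using block_transpose[OF P G] .
  have H: "block P ?H" using block_mult[OF G GT] .
  have sym: "y \<bullet> (?H *v z) = (transpose G *v y) \<bullet> (transpose G *v z)" for y z
    by (simp only: inner_matrix_vector[of "transpose G"] transpose_transpose matrix_vector_mul_assoc)
  have inj: "inj ((*v) G)" and injT: "inj ((*v) (transpose G))"
    using \<open>det G \<noteq> 0\<close> det_transpose[of G]
    by (metis det_nz_iff_inj matrix_of_matrix_vector_mul matrix_vector_mul_linear)+
  have "transpose G *v y0 \<noteq> 0"
    using injD[OF injT, of y0 0] \<open>y0 \<noteq> 0\<close> by (auto simp del: transpose_matrix_vector)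
  then have "0 < l * (y0 \<bullet> y0)"
    using form[OF \<open>y0 \<in> W\<close>] sym[of y0 y0] inner_gt_zero_iff[of "transpose G *v y0"]
    by (simp del: transpose_matrix_vector)
  then show "l > 0"
    by (metis inner_ge_zero mult_nonneg_nonneg mult_nonpos_nonneg not_less order_less_le)
  have W_add: "y + z \<in> W" if "y \<in> W" "z \<in> W" for y z
    using that by (simp add: W_def matrix_vector_right_distrib)
  have polar: "z \<bullet> (?H *v y) = l * (z \<bullet> y)" if "y \<in> W" "z \<in> W" for y z
  proof -
    have "z \<bullet> (?H *v y) = y \<bullet> (?H *v z)"
      unfolding sym by (rule inner_commute)
    then have "2 * (z \<bullet> (?H *v y)) = 2 * (l * (z \<bullet> y))"
      using form[OF W_add[OF that]] form[OF that(1)] form[OF that(2)]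
      by (simp add: matrix_vector_right_distrib inner_add_left inner_add_right inner_commute algebra_simps
          del: transpose_matrix_vector)
    then show ?thesis by simp
  qed
  have eig: "?H *v y = l *\<^sub>R y" if "y \<in> W" for y
  proof -
    let ?w = "?H *v y - l *\<^sub>R y"
    have "?w \<in> W"
      using that block_apply_proj[OF H, of y]
      by (simp add: W_def matrix_vector_mult_diff_distrib matrix_vector_mult_scaleR)
    then have "?w \<bullet> ?w = 0"
      using polar[OF that \<open>?w \<in> W\<close>] by (simp add: inner_diff_right)
    then show ?thesis by simp
  qed
  \<comment> \<open>The inverse of G on W, explicit because of G G^T = l there; its effect on norms
    is read off from the form.\<close>
  define u where "u = (\<lambda>y. (1 / l) *\<^sub>R (transpose G *v y))"
  have u: "G *v u y = y" "u y \<in> W" "u y \<bullet> u y = (y \<bullet> y) / l" if "y \<in> W" for y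
  proof -
    show "G *v u y = y"
      using eig[OF that] \<open>l > 0\<close>
      by (simp add: u_def matrix_vector_mult_scaleR matrix_vector_mul_assoc del: transpose_matrix_vector)
    show "u y \<in> W"
      using that block_apply_proj[OF GT, of y]
      by (simp add: W_def u_def matrix_vector_mult_scaleR del: transpose_matrix_vector)
    show "u y \<bullet> u y = (y \<bullet> y) / l"
      using form[OF that] sym[of y y] \<open>l > 0\<close>
      by (simp add: u_def field_simps power2_eq_square del: transpose_matrix_vector)
  qed
  have norm_iff: "norm (u y) \<le> 1 \<longleftrightarrow> norm y \<le> sqrt l" if "y \<in> W" for y
  proof -
    have "norm (u y) \<le> 1 \<longleftrightarrow> (y \<bullet> y) / l \<le> 1"
      using u(3)[OF that] by (simp add: norm_eq_sqrt_inner)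
    also have "\<dots> \<longleftrightarrow> y \<bullet> y \<le> l" using \<open>l > 0\<close> by (simp add: field_simps)
    finally show ?thesis by (simp add: norm_eq_sqrt_inner)
  qed
  show "(*v) G ` (W \<inter> cball 0 1) = W \<inter> cball 0 (sqrt l)"
  proof (intro equalityI subsetI)
    fix y assume "y \<in> (*v) G ` (W \<inter> cball 0 1)"
    then obtain v where v: "v \<in> W" "norm v \<le> 1" "y = G *v v" by auto
    then have "y \<in> W" using block_apply_proj[OF G, of v] by (simp add: W_def)
    moreover have "v = u y" using u(1)[OF \<open>y \<in> W\<close>] v(3) injD[OF inj] by metis
    ultimately show "y \<in> W \<inter> cball 0 (sqrt l)" using v(2) norm_iff by simp
  next
    fix y assume "y \<in> W \<inter> cball 0 (sqrt l)"
    then have "y = G *v u y" "u y \<in> W \<inter> cball 0 1"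
      using u norm_iff by auto
    then show "y \<in> (*v) G ` (W \<inter> cball 0 1)" by (rule image_eqI)
  qed
qed

text \<open>The linear map in \<open>ellipsoid_in\<close> is arbitrary off the direction space.
  Composing it with P and adding the complementary projection changes nothing on W and yields a
  block matrix.\<close>

lemma ellipsoid_in_block:
  fixes P :: "real^'n^'n"
  assumes P: "proj_mat P" and W_def: "W = {y. P *v y = y}" and dir: "affine_direction L = W"
    and E: "ellipsoid_in L E"
  obtains c G where "c \<in> L" "block P G" "E = (\<lambda>u. c + G *v u) ` (W \<inter> cball 0 1)"
proof -
  obtain c f where c: "c \<in> L" and f: "linear f" "f ` W = W" and E': "E = (\<lambda>u. c + f u) ` (W \<inter> cball 0 1)"
    using E unfolding ellipsoid_in_def dir by blast
  define g where "g = (\<lambda>y. f (P *v y) + (y - P *v y))"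
  interpret f: linear f by fact
  have "linear g"
    by (rule linearI) (simp_all add: g_def matrix_vector_right_distrib matrix_vector_mult_scaleR
        f.add f.scaleR algebra_simps)
  then have G: "matrix g *v y = g y" for y by (simp add: matrix_works)
  have fW: "P *v f (P *v y) = f (P *v y)" for y
  proof -
    have "P *v y \<in> W" using P by (simp add: W_def)
    then have "f (P *v y) \<in> W" using f(2) by blast
    then show ?thesis by (simp add: W_def)
  qed
  have "block P (matrix g)"
    unfolding block_def matrix_eq
    using P by (simp add: matrix_vector_mul_assoc[symmetric] G matrix_vector_mult_diff_rdistrib)
      (simp add: g_def matrix_vector_mult_diff_distrib matrix_vector_right_distrib fW f.zero)
  moreover have "E = (\<lambda>u. c + matrix g *v u) ` (W \<inter> cball 0 1)"
    unfolding E' G by (intro image_cong refl) (simp add: g_def W_def)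
  ultimately show ?thesis using c that by blast
qed

text \<open>Passes from pairs (c, G) that maximize the determinant to sets that maximize
  \<open>affine_volume\<close>. Both orderings agree because volume is a fixed positive multiple of
  |det G|, and every ellipsoid in L comes from a block matrix.\<close>

lemma john_ellipsoid_ball:
  fixes P G :: "real^'n^'n" and x :: "real^'n"
  assumes P: "proj_mat P" and W_def: "W = {y. P *v y = y}" and L_def: "L = (+) x ` W"
    and K0: "K0 = (\<lambda>y. y - x) ` K" "convex K0" "compact K0" "cball 0 e \<subseteq> K0" "0 < e"
    and max: "max_inscribed P K0 (c0, G)"
    and form: "\<And>y. y \<in> W \<Longrightarrow> y \<bullet> ((G ** transpose G) *v y) = l * (y \<bullet> y)"
    and y0: "y0 \<in> W" "y0 \<noteq> 0"
  shows "x + c0 \<in> L \<and> 0 < sqrt l \<and> john_ellipsoid L (K \<inter> L) (L \<inter> cball (x + c0) (sqrt l))"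
proof -
  have K: "y \<in> K \<longleftrightarrow> y - x \<in> K0" for y by (auto simp: K0(1))
  have G: "block P G" and c0: "P *v c0 = c0" and detG: "det G \<noteq> 0"
    using max max_inscribed_exists(2)[OF P K0(3-5) max] by (auto simp: max_inscribed_def inscribed_def)
  have W: "subspace W"
    by (auto simp: W_def subspace_def matrix_vector_right_distrib matrix_vector_mult_scaleR)
  have Lx: "y \<in> L \<longleftrightarrow> y - x \<in> W" for y
    unfolding L_def by (auto intro: image_eqI[of _ _ "y - x"])
  have dir: "affine_direction L = W"
  proof -
    have "\<exists>a b. y = a - b \<and> a - x \<in> W \<and> b - x \<in> W" if "y \<in> W" for y
      using that subspace_0[OF W] by (intro exI[of _ "x + y"] exI[of _ x]) simp
    moreover have "a - b \<in> W" if "a - x \<in> W" "b - x \<in> W" for a b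
      using subspace_diff[OF W that] by simp
    ultimately show ?thesis by (auto simp: affine_direction_def Lx)
  qed
  have PW: "P *v u \<in> W \<inter> cball 0 1" if "norm u \<le> 1" for u
    using P norm_proj_mat_le[OF P, of u] that by (simp add: W_def)
  have inscribed_iff: "(c - x, G') \<in> inscribed P K0 \<longleftrightarrow> (\<lambda>u. c + G' *v u) ` (W \<inter> cball 0 1) \<subseteq> K \<inter> L"
    if "c \<in> L" "block P G'" for c G'
  proof -
    have "(c - x, G') \<in> inscribed P K0 \<longleftrightarrow> (\<forall>u\<in>cball 0 1. c + G' *v (P *v u) \<in> K)"
      using that Lx[of c] by (simp add: inscribed_def K W_def add_diff_eq diff_add_eq)
    also have "\<dots> \<longleftrightarrow> (\<forall>u\<in>W \<inter> cball 0 1. c + G' *v u \<in> K)"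
    proof safe
      fix u :: "real^'n" assume a: "\<forall>u\<in>cball 0 1. c + G' *v (P *v u) \<in> K" and u: "u \<in> W" "u \<in> cball 0 1"
      have "P *v u = u" using u(1) by (simp add: W_def)
      with a u(2) show "c + G' *v u \<in> K" by force
    next
      fix u :: "real^'n" assume a: "\<forall>u\<in>W \<inter> cball 0 1. c + G' *v u \<in> K" and "u \<in> cball 0 1"
      then have "P *v u \<in> W \<inter> cball 0 1" using PW by simp
      with a show "c + G' *v (P *v u) \<in> K" by blast
    qed
    also have "\<dots> \<longleftrightarrow> (\<forall>u\<in>W \<inter> cball 0 1. c + G' *v u \<in> K \<inter> L)"
    proof -
      have "c + G' *v u \<in> L" if "u \<in> W" for u
      proof -
        have "G' *v u \<in> W"
          using that block_apply_proj[OF \<open>block P G'\<close>, of u] by (simp add: W_def)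
        then show ?thesis
          using subspace_add[OF W, of "c - x" "G' *v u"] \<open>c \<in> L\<close> Lx by (simp add: algebra_simps)
      qed
      then show ?thesis by blast
    qed
    finally show ?thesis by blast
  qed
  obtain \<kappa> where \<kappa>: "\<kappa> > 0" "\<And>c G. c \<in> L \<Longrightarrow> block P G \<Longrightarrow>
      affine_volume L ((\<lambda>u. c + G *v u) ` (W \<inter> cball 0 1)) = \<kappa> * \<bar>det G\<bar>"
    using affine_volume_block_image[OF P W_def L_def] by blast
  \<comment> \<open>Stated for every G' with the same form, since a competing maximizer may be
    presented by a matrix other than G.\<close>
  have shape: "0 < l \<and> (\<lambda>u. x + c0 + G' *v u) ` (W \<inter> cball 0 1) = L \<inter> cball (x + c0) (sqrt l)"
    if "block P G'" "det G' \<noteq> 0" "G' ** transpose G' = G ** transpose G" for G'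
  proof -
    have *: "0 < l" "(*v) G' ` (W \<inter> cball 0 1) = W \<inter> cball 0 (sqrt l)"
      using block_image_ball[OF P that(1,2) W_def _ y0, of l] form that(3) by simp_all
    have "(\<lambda>u. x + c0 + G' *v u) ` (W \<inter> cball 0 1) = (+) (x + c0) ` (*v) G' ` (W \<inter> cball 0 1)"
      by (simp only: image_image)
    also have "\<dots> = L \<inter> cball (x + c0) (sqrt l)"
    proof -
      have "x + c0 + w \<in> L \<longleftrightarrow> w \<in> W" for w
        using c0 by (simp add: Lx W_def matrix_vector_right_distrib)
      then have L: "y \<in> L \<longleftrightarrow> y - (x + c0) \<in> W" for y
        by (metis add_diff_cancel_left' diff_add_cancel add.commute)
      have translate: "y \<in> (+) (x + c0) ` S \<longleftrightarrow> y - (x + c0) \<in> S" for y S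
        by (auto intro: image_eqI[of _ _ "y - (x + c0)"])
      show ?thesis
        unfolding *(2) set_eq_iff translate by (simp add: L dist_norm norm_minus_commute)
    qed
    finally show ?thesis using *(1) by blast
  qed
  define E0 where "E0 = (\<lambda>u. x + c0 + G *v u) ` (W \<inter> cball 0 1)"
  have xc0: "x + c0 \<in> L" using c0 by (simp add: Lx W_def)
  have E0_in: "E0 \<subseteq> K \<inter> L"
    using inscribed_iff[OF xc0 G] max by (simp add: E0_def max_inscribed_def)
  have "ellipsoid_in L E0"
  proof -
    have "invertible G" using detG by (simp add: invertible_det_nz)
    then obtain C where C: "G ** C = mat 1" by (auto simp: invertible_def)
    have "(*v) G ` W = W"
    proof (intro equalityI subsetI)
      fix y assume "y \<in> W"
      then have "C *v y \<in> W"
        using block_apply_proj[OF block_inverse[OF G C], of y] by (simp add: W_def)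
      moreover have "y = G *v (C *v y)" by (simp add: matrix_vector_mul_assoc C)
      ultimately show "y \<in> (*v) G ` W" by blast
    qed (use block_apply_proj[OF G] in \<open>auto simp: W_def\<close>)
    then show ?thesis
      unfolding ellipsoid_in_def dir E0_def using xc0 by blast
  qed
  have vol_le: "\<bar>det G'\<bar> \<le> \<bar>det G\<bar>" if "(c, G') \<in> inscribed P K0" for c G'
    using max that by (force simp: max_inscribed_def)
  have "max_volume_ellipsoid L (K \<inter> L) E0"
    unfolding max_volume_ellipsoid_def
  proof (intro conjI allI impI \<open>ellipsoid_in L E0\<close> E0_in; elim conjE)
    fix E' assume "ellipsoid_in L E'" "E' \<subseteq> K \<inter> L"
    then obtain c G' where *: "c \<in> L" "block P G'" "E' = (\<lambda>u. c + G' *v u) ` (W \<inter> cball 0 1)"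
      using ellipsoid_in_block[OF P W_def dir] by blast
    then have "\<bar>det G'\<bar> \<le> \<bar>det G\<bar>"
      using inscribed_iff[of c G'] \<open>E' \<subseteq> K \<inter> L\<close> vol_le by blast
    then show "affine_volume L E' \<le> affine_volume L E0"
      using \<kappa> * xc0 G by (simp add: E0_def)
  qed
  \<comment> \<open>Uniqueness for pairs gives the same centre and G' G'^T = G G^T. By
    \<open>shape\<close> both sets are then the same ball, although G and G' may differ.\<close>
  moreover have "E' = E0" if E': "max_volume_ellipsoid L (K \<inter> L) E'" for E'
  proof -
    obtain c G' where *: "c \<in> L" "block P G'" "E' = (\<lambda>u. c + G' *v u) ` (W \<inter> cball 0 1)"
      using E' ellipsoid_in_block[OF P W_def dir] unfolding max_volume_ellipsoid_def by blast
    have in': "(c - x, G') \<in> inscribed P K0"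
      using inscribed_iff[of c G'] * E' unfolding max_volume_ellipsoid_def by blast
    have "affine_volume L E0 \<le> affine_volume L E'"
      using E' \<open>ellipsoid_in L E0\<close> E0_in unfolding max_volume_ellipsoid_def by blast
    then have "\<bar>det G\<bar> \<le> \<bar>det G'\<bar>"
      using \<kappa> * xc0 G by (simp add: E0_def)
    then have max': "max_inscribed P K0 (c - x, G')"
      using in' vol_le by (force simp: max_inscribed_def)
    have "c0 = c - x" "G ** transpose G = G' ** transpose G'"
      using max_inscribed_unique[OF P K0(2) max max' detG] by blast+
    moreover have "det G' \<noteq> 0"
      using max_inscribed_exists(2)[OF P K0(3-5) max'] by simp
    ultimately have "(\<lambda>u. x + c0 + G' *v u) ` (W \<inter> cball 0 1) = E0"
      using shape[of G'] shape[of G] *(2) G detG by (simp add: E0_def)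
    then show ?thesis using *(3) \<open>c0 = c - x\<close> by simp
  qed
  ultimately have "john_ellipsoid L (K \<inter> L) E0"
    unfolding john_ellipsoid_def by blast
  then show ?thesis
    using xc0 shape[OF G detG refl] by (simp add: E0_def)
qed

section \<open>The tautological bundle in Cartesian coordinates\<close>

text \<open>One numbering of the coordinates, fixed once and for all, identifies vectors indexed by
  \<open>'n\<close> with functions on the naturals.\<close>

definition cart_index :: "'n::finite \<Rightarrow> nat"
  where "cart_index = (SOME b. bij_betw b UNIV {..<CARD('n)})"

definition to_cart :: "(nat \<Rightarrow> real) \<Rightarrow> real^'n"
  where "to_cart t = (\<chi> j. t (cart_index j))"

text \<open>The value 0 from \<open>CARD('n)\<close> onwards places the image in the topological
  space \<open>Euclidean_space CARD('n)\<close>, where this map inverts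
  \<open>to_cart\<close>.\<close>

definition from_cart :: "real^'n \<Rightarrow> nat \<Rightarrow> real"
  where "from_cart y i = (if i < CARD('n) then y $ inv cart_index i else 0)"

lemma bij_cart_index: "bij_betw (cart_index :: 'n::finite \<Rightarrow> nat) UNIV {..<CARD('n)}"
proof -
  have "\<exists>b. bij_betw b (UNIV :: 'n set) {..<CARD('n)}"
    by (rule finite_same_card_bij) auto
  then show ?thesis unfolding cart_index_def by (rule someI_ex)
qed

lemma cart_index_less [simp]: "cart_index (j :: 'n::finite) < CARD('n)"
  using bij_cart_index by (auto simp: bij_betw_def)

lemma inv_cart_index [simp]: "inv cart_index (cart_index (j :: 'n::finite)) = j"
  using bij_betw_imp_inj_on[OF bij_cart_index] by (rule inv_f_f)

lemma cart_index_inv: "i < CARD('n) \<Longrightarrow> cart_index (inv cart_index i :: 'n::finite) = i"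
  using bij_betw_inv_into_right[OF bij_cart_index] by simp

lemma linear_to_cart: "linear (to_cart :: _ \<Rightarrow> real^'n)"
  by (rule linearI) (simp_all add: to_cart_def vec_eq_iff scaleR_fun_def)

lemma to_cart_from_cart [simp]: "to_cart (from_cart y) = (y :: real^'n)"
  by (simp add: to_cart_def from_cart_def vec_eq_iff)

lemma from_cart_to_cart:
  "t \<in> topspace (Euclidean_space CARD('n)) \<Longrightarrow> from_cart (to_cart t :: real^'n) = t"
  by (auto simp: to_cart_def from_cart_def fun_eq_iff topspace_Euclidean_space cart_index_inv)

lemma inner_to_cart: "(to_cart v :: real^'n) \<bullet> to_cart w = dot CARD('n) v w"
  using sum.reindex_bij_betw[OF bij_cart_index[where 'n='n], of "\<lambda>i. v i * w i"]
  by (simp add: dot_def to_cart_def inner_vec_def)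

lemma std_quadratic_form_to_cart: "std_quadratic_form CARD('n) v = (to_cart v :: real^'n) \<bullet> to_cart v"
  by (simp add: inner_to_cart dot_def std_quadratic_form_def power2_eq_square)

lemma subspace_to_cart: "subspace V \<Longrightarrow> subspace (to_cart ` V :: (real^'n) set)"
  by (rule linear_subspace_image[OF linear_to_cart])

text \<open>\<open>to_cart\<close> discards all coordinates from \<open>CARD('n)\<close> onwards. It
  is injective on V because those coordinates vanish there, and so it maps a basis of V to a basis
  of the image.\<close>

lemma dim_to_cart:
  assumes "subspace V" "V \<subseteq> topspace (Euclidean_space CARD('n))"
  shows "dim (to_cart ` V :: (real^'n) set) = dim V"
proof -
  obtain B where B: "B \<subseteq> V" "independent B" "V \<subseteq> span B" "card B = dim V"
    using real_vector.basis_exists by metis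
  have span: "span B = V"
    using B assms(1) by (simp add: span_minimal subset_antisym)
  have inj: "inj_on (to_cart :: _ \<Rightarrow> real^'n) V"
    using assms(2) by (intro inj_on_inverseI[of _ from_cart]) (auto intro: from_cart_to_cart)
  have "independent (to_cart ` B :: (real^'n) set)"
    using B(2) inj by (intro linear_independent_injective_image[OF linear_to_cart]) (simp_all add: span)
  moreover have "span (to_cart ` B :: (real^'n) set) = to_cart ` V"
    using linear_span_image[OF linear_to_cart, of B] span by simp
  ultimately have "dim (to_cart ` V :: (real^'n) set) = card (to_cart ` B :: (real^'n) set)"
    by (metis dim_eq_card_independent dim_span)
  also have "\<dots> = dim V"
    using inj_on_subset[OF inj B(1)] B(4) by (simp add: card_image)
  finally show ?thesis .
qed

text \<open>P is the sum of b b^T over an orthonormal basis of W.\<close>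

lemma proj_mat_exists:
  fixes W :: "(real^'n) set"
  assumes "subspace W"
  obtains P where "proj_mat P" "W = {y. P *v y = y}"
proof -
  obtain B where B: "B \<subseteq> W" "pairwise orthogonal B" "\<And>x. x \<in> B \<Longrightarrow> norm x = 1"
      "independent B" "card B = dim W" "span B = W"
    using orthonormal_basis_subspace[OF assms] by blast
  have "finite B" using B(4) by (rule independent_imp_finite)
  define f where "f = (\<lambda>y. \<Sum>b\<in>B. (b \<bullet> y) *\<^sub>R b)"
  have "linear f"
    by (rule linearI) (simp_all add: f_def inner_add_right scaleR_add_left sum.distrib scaleR_sum_right)
  then have P: "matrix f *v y = f y" for y by (simp add: matrix_works)
  have fW: "f y \<in> W" for y
    unfolding f_def using assms B(1) by (intro subspace_sum subspace_scale) auto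
  have fb: "b \<bullet> f y = b \<bullet> y" if "b \<in> B" for b y
  proof -
    have "b \<bullet> f y = (\<Sum>a\<in>B. if a = b then b \<bullet> y else 0)"
      unfolding f_def inner_sum_right using B(2,3) that
      by (intro sum.cong) (auto simp: pairwise_def orthogonal_def inner_commute dot_square_norm)
    then show ?thesis using that \<open>finite B\<close> by simp
  qed
  have fix_W: "f y = y" if "y \<in> W" for y
  proof -
    have "orthogonal (y - f y) (y - f y)"
    proof (rule orthogonal_to_span[of "y - f y" B])
      show "y - f y \<in> span B" using B(6) assms fW that by (simp add: subspace_diff)
      show "orthogonal (y - f y) b" if "b \<in> B" for b
        using fb[OF that, of y] by (simp add: orthogonal_def inner_commute[of _ b] inner_diff_right)
    qed
    then show ?thesis by (simp add: orthogonal_def)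
  qed
  have adj: "f x \<bullet> y = x \<bullet> f y" for x y
    by (simp add: f_def inner_sum_left inner_sum_right inner_commute mult.commute)
  have "(transpose (matrix f) *v x) \<bullet> y = (matrix f *v x) \<bullet> y" for x y
    using inner_matrix_vector[of "transpose (matrix f)" x y] by (simp add: P adj del: transpose_matrix_vector)
  then have "transpose (matrix f) *v x = matrix f *v x" for x
    using vector_eq_rdot by blast
  then have "transpose (matrix f) = matrix f"
    unfolding matrix_eq by blast
  moreover have "matrix f ** matrix f = matrix f"
    by (simp add: matrix_eq matrix_vector_mul_assoc[symmetric] P fix_W fW)
  ultimately have "proj_mat (matrix f)" by (simp add: proj_mat_def)
  moreover have "W = {y. matrix f *v y = y}"
    using fix_W fW by (auto simp: P) metis
  ultimately show ?thesis using that by blast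
qed

text \<open>Built from the entries of \<open>proj_matrix\<close>, through which the Grassmannian
  gets its topology; continuity in V is therefore immediate, and the projection property is what
  remains to be shown.\<close>

definition tautological_proj :: "(nat \<Rightarrow> real) set \<Rightarrow> real^'n^'n"
  where "tautological_proj V = (\<chi> i j. proj_matrix CARD('n) V (cart_index i) (cart_index j))"

text \<open>Evaluates the definite description. The difference d of two candidates lies in the
  subspace and is orthogonal to it, hence to itself.\<close>

lemma orth_proj_cart:
  fixes P :: "real^'n^'n"
  assumes V: "V \<subseteq> topspace (Euclidean_space CARD('n))"
    and P: "proj_mat P" "to_cart ` V = {y. P *v y = y}"
  shows "orth_proj CARD('n) V u = from_cart (P *v to_cart u)"
  unfolding orth_proj_def
proof (rule the_equality)
  let ?n = "CARD('n)"
  have mem: "from_cart y \<in> V" if "P *v y = y" for y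
  proof -
    have "y \<in> to_cart ` V" using that P(2) by blast
    then obtain v where "v \<in> V" "y = to_cart v" by blast
    then show ?thesis using V from_cart_to_cart by fastforce
  qed
  have fixed: "P *v to_cart w = to_cart w" if "w \<in> V" for w
    using that P(2) by blast
  have dot: "dot ?n (u - p) w = (to_cart u - to_cart p) \<bullet> (to_cart w :: real^'n)" for p w
    by (simp add: inner_to_cart[symmetric] linear_diff[OF linear_to_cart])
  show "from_cart (P *v to_cart u) \<in> V \<and> (\<forall>w\<in>V. dot ?n (u - from_cart (P *v to_cart u)) w = 0)"
  proof (intro conjI ballI mem)
    show "P *v (P *v to_cart u) = P *v to_cart u" using P(1) by simp
    fix w assume "w \<in> V"
    then show "dot ?n (u - from_cart (P *v to_cart u)) w = 0"
      using fixed[of w] proj_mat_inner[OF P(1), of "to_cart u" "to_cart w"]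
      by (simp add: dot inner_diff_left)
  qed
  fix p assume p: "p \<in> V \<and> (\<forall>w\<in>V. dot ?n (u - p) w = 0)"
  define d where "d = to_cart p - P *v to_cart u"
  have "P *v d = d"
    using fixed[of p] p P(1) by (simp add: d_def matrix_vector_mult_diff_distrib)
  then have "(to_cart u - to_cart p) \<bullet> d = 0"
    using p mem[of d] dot[of p "from_cart d"] by simp
  moreover have "(to_cart u - P *v to_cart u) \<bullet> d = 0"
    using proj_mat_inner[OF P(1), of "to_cart u" d] \<open>P *v d = d\<close> by (simp add: inner_diff_left)
  ultimately have "d \<bullet> d = 0" by (simp add: d_def inner_diff_left algebra_simps)
  then have "to_cart p = P *v to_cart u" by (simp add: d_def)
  then show "p = from_cart (P *v to_cart u)"
    using p V from_cart_to_cart by (metis subsetD)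
qed

lemma tautological_proj:
  assumes V: "V \<in> grassmannian CARD('n) k"
  shows "proj_mat (tautological_proj V :: real^'n^'n)"
    and "to_cart ` V = {y. (tautological_proj V :: real^'n^'n) *v y = y}"
proof -
  have V': "subspace V" "V \<subseteq> topspace (Euclidean_space CARD('n))"
    using V by (auto simp: grassmannian_def)
  obtain P :: "real^'n^'n" where P: "proj_mat P" "to_cart ` V = {y. P *v y = y}"
    using proj_mat_exists[OF subspace_to_cart[OF V'(1)]] by blast
  have "tautological_proj V = P"
  proof -
    have "tautological_proj V $ i $ j = P $ i $ j" for i j
    proof -
      have "to_cart (\<lambda>l. of_bool (l = cart_index i)) = (axis i 1 :: real^'n)"
        using bij_cart_index[where 'n='n] by (auto simp: to_cart_def axis_def vec_eq_iff bij_betw_def inj_on_def)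
      then have "tautological_proj V $ i $ j = (P *v axis i 1) $ j"
        by (simp add: tautological_proj_def proj_matrix_def orth_proj_cart[OF V'(2) P] from_cart_def)
      \<comment> \<open>The rows of \<open>proj_matrix\<close> are the images of the unit vectors,
        so the transpose of P appears; P is symmetric.\<close>
      also have "\<dots> = transpose P $ i $ j"
        by (simp add: matrix_vector_mul_component inner_axis transpose_def)
      finally show ?thesis using P(1) by (simp add: proj_mat_def)
    qed
    then show ?thesis by (simp add: vec_eq_iff)
  qed
  with P show "proj_mat (tautological_proj V :: real^'n^'n)"
    "to_cart ` V = {y. (tautological_proj V :: real^'n^'n) *v y = y}" by simp_all
qed

text \<open>The evaluation factors through (V, v) -> (P, y) -> y . H(P) y. The first map is
  continuous because matrix entries are continuous in the pulled-back topology; the second inherits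
  continuity from H.\<close>

lemma continuous_quadratic_section_cart:
  fixes H :: "real^'n^'n \<Rightarrow> real^'n^'n"
  assumes cont: "continuous_on {P. proj_mat P} H" and sym: "\<And>P. transpose (H P) = H P"
  shows "continuous_quadratic_section CARD('n) k
    (\<lambda>V v. to_cart v \<bullet> (H (tautological_proj V) *v to_cart v))"
  unfolding continuous_quadratic_section_def
proof (intro conjI ballI)
  let ?n = "CARD('n)"
  fix V assume "V \<in> grassmannian ?n k"
  let ?A = "H (tautological_proj V)"
  let ?B = "\<lambda>v w. to_cart v \<bullet> (?A *v to_cart w)"
  have "bilinear ?B"
    unfolding bilinear_def
    by (auto intro!: linearI simp: linear_add[OF linear_to_cart] linear_scale[OF linear_to_cart]
        inner_add_left inner_add_right matrix_vector_right_distrib matrix_vector_mult_scaleR)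
  moreover have "?B v w = ?B w v" for v w
    using inner_matrix_vector[of ?A "to_cart v" "to_cart w"]
    by (simp add: sym inner_commute del: transpose_matrix_vector)
  ultimately show "quadratic_form_on V (\<lambda>v. ?B v v)"
    unfolding quadratic_form_on_def by blast
next
  let ?n = "CARD('n)"
  let ?X = "tautological_bundle ?n k"
  define F :: "(nat \<Rightarrow> real) set \<times> (nat \<Rightarrow> real) \<Rightarrow> (real^'n^'n) \<times> (real^'n)"
    where "F = (\<lambda>x. (tautological_proj (fst x), to_cart (snd x)))"
  have entry: "continuous_map ?X euclideanreal (\<lambda>x. proj_matrix ?n (fst x) i j)" for i j
  proof -
    have "continuous_on UNIV (\<lambda>M :: nat \<Rightarrow> nat \<Rightarrow> real. M i j)"
      by (rule continuous_on_product_then_coordinatewise[OF continuous_on_product_coordinates])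
    then have "continuous_map (grassmannian_topology ?n k) euclideanreal ((\<lambda>M. M i j) \<circ> proj_matrix ?n)"
      unfolding grassmannian_topology_def by (intro continuous_map_pullback) simp
    from continuous_map_compose[OF continuous_map_fst this]
    show ?thesis
      unfolding tautological_bundle_def by (intro continuous_map_from_subtopology) (simp add: o_def)
  qed
  have coord: "continuous_map ?X euclideanreal (\<lambda>x. snd x i)" for i
  proof -
    have "continuous_map (Euclidean_space ?n) euclideanreal (\<lambda>v. v i)"
      unfolding Euclidean_space_def
      by (intro continuous_map_from_subtopology continuous_map_product_projection) simp
    from continuous_map_compose[OF continuous_map_snd this]
    show ?thesis
      unfolding tautological_bundle_def by (intro continuous_map_from_subtopology) (simp add: o_def)
  qed
  have "continuous_map ?X euclidean F"
    unfolding continuous_map_atin limitin_canonical_iff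
  proof
    fix x assume x: "x \<in> topspace ?X"
    have "((\<lambda>y. proj_matrix ?n (fst y) i j) \<longlongrightarrow> proj_matrix ?n (fst x) i j) (atin ?X x)"
      "((\<lambda>y. snd y i) \<longlongrightarrow> snd x i) (atin ?X x)" for i j
      using entry coord x by (auto simp: continuous_map_atin)
    then show "(F \<longlongrightarrow> F x) (atin ?X x)"
      unfolding F_def tautological_proj_def to_cart_def by (intro tendsto_Pair tendsto_vec_lambda)
  qed
  \<comment> \<open>H is assumed continuous on projections only, so F has to be seen as a map into
    them.\<close>
  moreover have "topspace ?X \<subseteq> (SIGMA V:grassmannian ?n k. V)"
    by (auto simp: tautological_bundle_def)
  then have "F x \<in> {P. proj_mat P} \<times> UNIV" if "x \<in> topspace ?X" for x
    using tautological_proj(1) that by (force simp: F_def)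
  ultimately have F: "continuous_map ?X (top_of_set ({P. proj_mat P} \<times> UNIV)) F"
    by (auto simp: continuous_map_in_subtopology)
  have "continuous_on ({P. proj_mat P} \<times> UNIV) (\<lambda>(P, y). y \<bullet> (H P *v y))"
  proof -
    have "continuous_on ({P. proj_mat P} \<times> UNIV) (\<lambda>z :: (real^'n^'n) \<times> (real^'n). H (fst z))"
      by (rule continuous_on_compose2[OF cont]) (auto intro: continuous_intros)
    moreover have "continuous_on ({P. proj_mat P} \<times> UNIV) (\<lambda>z :: (real^'n^'n) \<times> (real^'n). snd z)"
      by (intro continuous_intros)
    ultimately show ?thesis
      unfolding continuous_on_def split_beta
      by (intro ballI tendsto_inner tendsto_matrix_vector_mult; blast)
  qed
  then have "continuous_map (top_of_set ({P. proj_mat P} \<times> UNIV)) euclideanreal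
      (\<lambda>(P, y :: real^'n). y \<bullet> (H P *v y))"
    by simp
  from continuous_map_compose[OF F this]
  show "continuous_map ?X euclideanreal
      (\<lambda>(V, v). to_cart v \<bullet> (H (tautological_proj V) *v to_cart v))"
    by (simp add: F_def o_def case_prod_unfold)
qed

theorem corollary9:
  fixes p \<alpha> k m N :: nat
    and K :: "nat \<Rightarrow> (real ^ 'n) set"
    and x :: "real ^ 'n"
  assumes "prime p" and "k = 2 * p ^ \<alpha>" and "m \<ge> 1" and "N > 0"
    and "\<forall>n'\<ge>N. \<forall>s :: nat \<Rightarrow> (nat \<Rightarrow> real) set \<Rightarrow> (nat \<Rightarrow> real) \<Rightarrow> real.
      (\<forall>i\<in>{1..m}. continuous_quadratic_section n' k (s i)) \<longrightarrow>
      (\<exists>V\<in>grassmannian n' k. \<forall>i\<in>{1..m}. \<exists>c::real. \<forall>v\<in>V.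
        s i V v = c * std_quadratic_form n' v)"
    and "CARD('n) \<ge> N"
    and "\<forall>i\<in>{1..m}. convex_body (K i)"
    and "x \<in> interior (\<Inter>i\<in>{1..m}. K i)"
  shows "\<exists>L :: (real ^ 'n) set. affine L \<and> aff_dim L = int k \<and> x \<in> L \<and>
    (\<forall>i\<in>{1..m}. \<exists>c\<in>L. \<exists>r>0. john_ellipsoid L (K i \<inter> L) (L \<inter> cball c r))"
proof -
  let ?n = "CARD('n)"
  \<comment> \<open>Moving x to the origin turns affine subspaces through x into linear
    ones.\<close>
  define K0 where "K0 = (\<lambda>i. (\<lambda>y. y - x) ` K i)"
  define s where "s = (\<lambda>i V v. to_cart v \<bullet> (john_form (K0 i) (tautological_proj V) *v to_cart v))"
  have K0: "convex (K0 i)" "compact (K0 i)" "\<exists>e>0. cball 0 e \<subseteq> K0 i" if "i \<in> {1..m}" for i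
  proof -
    have "convex_body (K i)" using assms(7) that by blast
    then show "convex (K0 i)" "compact (K0 i)"
      unfolding K0_def convex_body_def
      by (auto intro!: compact_continuous_image continuous_intros convex_translation_subtract)
    have "x \<in> interior (K i)"
      using assms(8) interior_mono[of "\<Inter>i\<in>{1..m}. K i" "K i"] that by blast
    then obtain e where e: "e > 0" "cball x e \<subseteq> K i" by (auto simp: mem_interior_cball)
    have "z \<in> K0 i" if "z \<in> cball 0 e" for z
    proof -
      have "x + z \<in> cball x e" using that by (simp add: dist_norm)
      then have "x + z \<in> K i" using e(2) by blast
      then show ?thesis unfolding K0_def by (intro image_eqI[of _ _ "x + z"]) simp_all
    qed
    with e(1) show "\<exists>e>0. cball 0 e \<subseteq> K0 i" by blast
  qed
  have "continuous_quadratic_section ?n k (s i)" if "i \<in> {1..m}" for i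
  proof -
    obtain e where "e > 0" "cball 0 e \<subseteq> K0 i" using K0(3)[OF \<open>i \<in> {1..m}\<close>] by blast
    then have "continuous_on {P. proj_mat P} (john_form (K0 i))"
      using K0[OF that] by (intro continuous_on_john_form)
    moreover have "transpose (john_form (K0 i) P) = john_form (K0 i) P" for P
      by (simp add: john_form_def Let_def matrix_transpose_mul)
    ultimately show ?thesis
      unfolding s_def by (rule continuous_quadratic_section_cart)
  qed
  \<comment> \<open>The hypothesis is applied with \<open>n' = CARD('n)\<close> and to all bodies
    together, so a single V serves every index.\<close>
  then obtain V where V: "V \<in> grassmannian ?n k"
    and multiple: "\<forall>i\<in>{1..m}. \<exists>c. \<forall>v\<in>V. s i V v = c * std_quadratic_form ?n v"
    using assms(5)[rule_format, of ?n s] assms(6) by blast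
  define W :: "(real^'n) set" where "W = to_cart ` V"
  define P :: "real^'n^'n" where "P = tautological_proj V"
  have P: "proj_mat P" and W_eq: "W = {y. P *v y = y}"
    using tautological_proj[OF V] by (simp_all add: P_def W_def)
  have W: "subspace W" "dim W = k"
    using V dim_to_cart[of V, where 'n='n] subspace_to_cart[of V, where 'n='n]
    by (auto simp: grassmannian_def W_def)
  define L where "L = (+) x ` W"
  \<comment> \<open>A nonzero vector of W is needed to see that the multiple l is positive: on the
    zero space the form would say nothing about l.\<close>
  have "k > 0" using assms(1,2) prime_gt_0_nat by simp
  then have "W \<noteq> {0}" using W(2) by auto
  then obtain y0 where y0: "y0 \<in> W" "y0 \<noteq> 0" using subspace_0[OF W(1)] by blast
  have "\<exists>c\<in>L. \<exists>r>0. john_ellipsoid L (K i \<inter> L) (L \<inter> cball c r)" if i: "i \<in> {1..m}" for i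
  proof -
    obtain e where e: "e > 0" "cball 0 e \<subseteq> K0 i" using K0(3)[OF i] by blast
    obtain c G where max: "max_inscribed P (K0 i) (c, G)"
      using max_inscribed_exists(1)[OF P K0(2)[OF i] e(2,1)] by auto
    have form: "john_form (K0 i) P = G ** transpose G"
      by (rule john_form_eq[OF P K0(1,2)[OF i] e(2,1) max])
    obtain l where l: "\<forall>v\<in>V. s i V v = l * std_quadratic_form ?n v" using multiple i by blast
    have "y \<bullet> ((G ** transpose G) *v y) = l * (y \<bullet> y)" if "y \<in> W" for y
      using that l by (auto simp: W_def s_def std_quadratic_form_to_cart form P_def[symmetric])
    from john_ellipsoid_ball[OF P W_eq L_def K0_def[THEN fun_cong] K0(1,2)[OF i] e(2,1) max this y0]
    show ?thesis by blast
  qed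
  moreover have "affine L" "aff_dim L = int k" "x \<in> L"
    using W subspace_0[OF W(1)] aff_dim_translation_eq[of x W]
    by (auto simp: L_def aff_dim_subspace affine_translation[symmetric] subspace_imp_affine image_iff)
  ultimately show ?thesis by blast
qed

end
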